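(* Consider the linear regression model $Y_i=\beta_0+\sum_{j=1}^p\beta_jx_{ij}+\varepsilon_i$, $i=1,\dots,n$, with deterministic design, where $\varepsilon_1,\dots,\varepsilon_n$ are i.i.d. Gaussian $\mathcal{N}(0,\sigma^2)$, and let $p\ge n$. Let $k>1$ be fixed, $K=kp_0$, and assume the consistency condition $$\lim_{n\to\infty}\min\left\{\frac{\Delta(s)}{p_0\ln p}\colon s_0\nsubseteq s,\ k(s)\le K\right\}=\infty .$$ Let $\mathrm{mBIC}(s)=n\ln \mathrm{RSS}(s)+k(s)\ln n+2k(s)\ln p$. If $p_0\ln p=O(n^\alpha)$ and $\ln p=o(n^{1-\alpha}\ln n)$ for some $\alpha\in[\tfrac12,1)$, then $\mathrm{mBIC}$ is consistent, that is, $$\mathrm{P}\left(\mathrm{mBIC}(s)>\mathrm{mBIC}(s_0)\ \text{ for all } s\ne s_0 \text{ with } k(s)\le K\right)\xrightarrow{n\to\infty}1 .$$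
   Context: Asymptotics are as $n\to\infty$. The number of predictors $p=p_n$, the design $(x_{ij})$, the coefficients $\beta_0,\beta_1,\dots,\beta_p$, the true model and its size $p_0\ge1$ may all depend on $n$; $\sigma>0$, $k$ and $\alpha$ do not. Models are subsets $s\subseteq\{1,\dots,p\}$, and $k(s)$ is the number of elements of $s$. The true model is $s_0=\{j\in\{1,\dots,p\}\colon\beta_j\ne0\}$, and $p_0=k(s_0)$. $X(s)$ is the matrix formed by the columns $(x_{1j},\dots,x_{nj})^T$ of the design with indices $j\in s$, together with the intercept column of ones, which belongs to every model and is not counted in $k(s)$; $\beta(s)$ is the corresponding vector of coefficients. $H(s)$ is the matrix of the orthogonal projection of $\mathbb{R}^n$ onto the span of the columns of $X(s)$. $\mathrm{RSS}(s)=Y^T[I-H(s)]Y$ is the residual sum of squares of model $s$. Further, $\mu=X(s_0)\beta(s_0)$ and $\Delta(s)=\|\mu-H(s)\mu\|^2$ (Euclidean norm). *)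

theory Defs
  imports
    "HOL-Probability.Probability"
    "HOL-Library.Landau_Symbols"
    "Jordan_Normal_Form.VS_Connect"
begin

(* Observations and predictors are numbered from 1, vector and matrix entries from 0.
   Hence entry i of a vector of length n belongs to observation Suc i, and x i j is
   the value of predictor j at observation i. *)

definition design_col :: "nat \<Rightarrow> (nat \<Rightarrow> nat \<Rightarrow> real) \<Rightarrow> nat \<Rightarrow> real Matrix.vec" where
  "design_col n x j = Matrix.vec n (\<lambda>i. x (Suc i) j)"

definition design_mat :: "nat \<Rightarrow> (nat \<Rightarrow> nat \<Rightarrow> real) \<Rightarrow> nat set \<Rightarrow> real mat" where
  "design_mat n x s =
     mat_of_cols n (Matrix.vec n (\<lambda>_. 1) # map (design_col n x) (sorted_list_of_set s))"

(* b 0 is the intercept, in the same position as the column of ones in design_mat *)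
definition coef_vec :: "(nat \<Rightarrow> real) \<Rightarrow> nat set \<Rightarrow> real Matrix.vec" where
  "coef_vec b s = vec_of_list (b 0 # map b (sorted_list_of_set s))"

definition is_orth_proj :: "nat \<Rightarrow> real Matrix.vec set \<Rightarrow> real mat \<Rightarrow> bool" where
  "is_orth_proj n W H \<longleftrightarrow>
     H \<in> carrier_mat n n \<and>
     (\<forall>v\<in>carrier_vec n. H *\<^sub>v v \<in> W \<and> (\<forall>w\<in>W. scalar_prod (v - H *\<^sub>v v) w = 0))"

(* The columns of design_mat n x s may be linearly dependent; the projection exists
   and is unique in any case. *)
definition hat_mat :: "nat \<Rightarrow> (nat \<Rightarrow> nat \<Rightarrow> real) \<Rightarrow> nat set \<Rightarrow> real mat" where
  "hat_mat n x s =
     (THE H. is_orth_proj n (vec_space.col_space n (design_mat n x s)) H)"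

definition RSS :: "nat \<Rightarrow> (nat \<Rightarrow> nat \<Rightarrow> real) \<Rightarrow> real Matrix.vec \<Rightarrow> nat set \<Rightarrow> real" where
  "RSS n x y s = scalar_prod y ((1\<^sub>m n - hat_mat n x s) *\<^sub>v y)"

(* Isabelle's ln 0 = 0 makes mBIC differ from the usual convention (ln 0 = -infinity)
   where RSS = 0.  If card s + 1 < n, this has probability 0 under Gaussian errors. *)
definition mBIC ::
    "nat \<Rightarrow> nat \<Rightarrow> (nat \<Rightarrow> nat \<Rightarrow> real) \<Rightarrow> real Matrix.vec \<Rightarrow> nat set \<Rightarrow> real" where
  "mBIC n p x y s =
     real n * ln (RSS n x y s) + real (card s) * ln (real n) + 2 * real (card s) * ln (real p)"

definition true_model :: "nat \<Rightarrow> (nat \<Rightarrow> real) \<Rightarrow> nat set" where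
  "true_model p b = {j \<in> {1..p}. b j \<noteq> 0}"

definition mean_vec ::
    "nat \<Rightarrow> nat \<Rightarrow> (nat \<Rightarrow> nat \<Rightarrow> real) \<Rightarrow> (nat \<Rightarrow> real) \<Rightarrow> real Matrix.vec" where
  "mean_vec n p x b = design_mat n x (true_model p b) *\<^sub>v coef_vec b (true_model p b)"

definition eucl_norm :: "real Matrix.vec \<Rightarrow> real" where
  "eucl_norm v = L2_set (vec_index v) {..<dim_vec v}"

definition Delta ::
    "nat \<Rightarrow> nat \<Rightarrow> (nat \<Rightarrow> nat \<Rightarrow> real) \<Rightarrow> (nat \<Rightarrow> real) \<Rightarrow> nat set \<Rightarrow> real" where
  "Delta n p x b s = (eucl_norm (mean_vec n p x b - hat_mat n x s *\<^sub>v mean_vec n p x b))\<^sup>2"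

definition response ::
    "nat \<Rightarrow> nat \<Rightarrow> (nat \<Rightarrow> nat \<Rightarrow> real) \<Rightarrow> (nat \<Rightarrow> real) \<Rightarrow> (nat \<Rightarrow> real) \<Rightarrow> real Matrix.vec" where
  "response n p x b e =
     Matrix.vec n (\<lambda>i. b 0 + (\<Sum>j = 1..p. b j * x (Suc i) j) + e (Suc i))"

end

(*
The Gaussian moment generating function E exp(l |U e|^2) = (1 - 2 l)^(-r/2), for r orthonormal
vectors U, gives Chernoff bounds for the projections of the noise. They are summed over the models
with the binomial weights (1 + c/p)^p <= exp c, which removes the combinatorics of the union bound.

If s contains s0 and j more predictors, RSS(s0) - RSS(s) is such a projection of rank at most j and,
with high probability, at most sigma^2 j (2 ln p + (3/4) ln n) for all s simultaneously. Moreover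
RSS(s) >= sigma^2 n (1 - 2 h) with h = ln n / (32 ln p), so that n ln (RSS(s0) / RSS(s)) stays below
the penalty j (ln n + 2 ln p). The assumptions on p0 ln p and ln p are what makes
8 K ln p <= h n and n h^2 -> infinity.

If s misses part of s0, then all projections of the noise are at most 8 sigma^2 K ln p, which is
negligible against Delta(s); hence RSS(s) - RSS(s0) >= Delta(s) / 4, and n times the logarithm of
the ratio exceeds the largest possible gain 3 p0 ln p in the penalty.
*)
theory Submission
  imports Defs "HOL-Real_Asymp.Real_Asymp"
begin

section \<open>Orthonormal bases and residual sums of squares\<close>

text \<open>The threshold for overfitting models, \<open>2 * j * L\<close> with
  \<open>L = P + 3/8 * N\<close>, has to fit between two demands. Write c for the coefficient of
  \<open>N\<close> in \<open>L\<close>. The union bound leaves a quantity \<open>q\<close> of order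
  \<open>sqrt L * n powr (- c)\<close>; the assumptions bound ln p by sqrt n times ln n, so c > 1/4
  suffices to make it vanish. On the other side \<open>2 * (P + c * N)\<close> must stay below
  \<open>(1 - 2 * h) * (N + 2 * P)\<close>. Since \<open>h * P = N / 32\<close> and
  \<open>h \<le> 1 / 32\<close>, the factor \<open>1 - 2 * h\<close> costs at most
  \<open>3/16 * N\<close>, which leaves room for c < 13/32. The value 3/8 lies between. In misfit
  models the noise also enters through its inner product with the residual of the mean. This is not
  part of a projection onto the columns of the model, but the normalised residual is orthogonal to
  them. Appended to an orthonormal basis of the model, it brings the cross term under the same
  chi-square bound.\<close>

lemma scalar_prod_self: "scalar_prod v v = (\<Sum>i<dim_vec v. (v $ i)\<^sup>2)" for v :: "real Matrix.vec"
  by (simp add: scalar_prod_def power2_eq_square atLeast0LessThan)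

lemma scalar_prod_self_nonneg: "0 \<le> scalar_prod v v" for v :: "real Matrix.vec"
  by (simp add: scalar_prod_self sum_nonneg)

lemma scalar_prod_self_eq_0D:
  fixes v :: "real Matrix.vec"
  assumes "scalar_prod v v = 0" "v \<in> carrier_vec n"
  shows "v = 0\<^sub>v n"
  using assms by (intro eq_vecI) (auto simp: scalar_prod_self sum_nonneg_eq_0_iff)

text \<open>Lists rather than sets, so that bases of nested models arise by appending and moments
  are computed by induction. Orthogonality is demanded of earlier against later members; symmetry of
  the inner product gives the rest.\<close>

definition orthon :: "nat \<Rightarrow> real Matrix.vec list \<Rightarrow> bool" where
  "orthon n us \<longleftrightarrow>
     (\<forall>u\<in>set us. u \<in> carrier_vec n \<and> scalar_prod u u = 1) \<and> sorted_wrt (\<lambda>u v. scalar_prod u v = 0) us"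

text \<open>For an orthonormal list this is the squared length of the projection of \<open>v\<close>
  onto its span. If \<open>v\<close> is standard Gaussian, it is chi-square distributed with
  \<open>length us\<close> degrees of freedom.\<close>

definition energy :: "real Matrix.vec list \<Rightarrow> real Matrix.vec \<Rightarrow> real" where
  "energy us v = (\<Sum>u\<leftarrow>us. (scalar_prod u v)\<^sup>2)"

fun proj :: "nat \<Rightarrow> real Matrix.vec list \<Rightarrow> real Matrix.vec \<Rightarrow> real Matrix.vec" where
  "proj n [] v = 0\<^sub>v n"
| "proj n (u # us) v = scalar_prod u v \<cdot>\<^sub>v u + proj n us v"

definition proj_mat :: "nat \<Rightarrow> real Matrix.vec list \<Rightarrow> real mat" where
  "proj_mat n us = mat n n (\<lambda>(i, j). \<Sum>u\<leftarrow>us. u $ i * u $ j)"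

lemma energy_simps [simp]:
  "energy [] v = 0" "energy (u # us) v = (scalar_prod u v)\<^sup>2 + energy us v"
  "energy (us @ vs) v = energy us v + energy vs v"
  by (simp_all add: energy_def)

lemma energy_nonneg: "0 \<le> energy us v"
  unfolding energy_def by (rule sum_list_nonneg) auto

lemma orthon_Cons:
  "orthon n (u # us) \<longleftrightarrow>
     u \<in> carrier_vec n \<and> scalar_prod u u = 1 \<and> (\<forall>v\<in>set us. scalar_prod u v = 0) \<and> orthon n us"
  by (auto simp: orthon_def)

lemma orthon_append:
  "orthon n (us @ vs) \<longleftrightarrow>
     orthon n us \<and> orthon n vs \<and> (\<forall>u\<in>set us. \<forall>v\<in>set vs. scalar_prod u v = 0)"
  by (auto simp: orthon_def sorted_wrt_append)

lemma orthon_carrier: "orthon n us \<Longrightarrow> set us \<subseteq> carrier_vec n"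
  by (auto simp: orthon_def)

lemma proj_carrier [simp]: "set us \<subseteq> carrier_vec n \<Longrightarrow> proj n us v \<in> carrier_vec n"
  by (induction us) auto

lemma proj_mat_mult_vec:
  assumes "set us \<subseteq> carrier_vec n" "v \<in> carrier_vec n"
  shows "proj_mat n us *\<^sub>v v = proj n us v"
  using assms(1)
proof (induction us)
  case Nil
  show ?case using assms(2) by (intro eq_vecI) (auto simp: proj_mat_def scalar_prod_def)
next
  case (Cons u us)
  have "(proj_mat n (u # us) *\<^sub>v v) $ i = (scalar_prod u v \<cdot>\<^sub>v u + proj n us v) $ i" if "i < n" for i
  proof -
    have "proj n us v $ i = (proj_mat n us *\<^sub>v v) $ i"
      using Cons by simp
    moreover have "dim_vec v = n" "dim_vec u = n" "dim_vec (proj n us v) = n"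
      using assms(2) Cons.prems proj_carrier[of us n v] by (auto simp del: proj_carrier)
    ultimately show ?thesis using that
      by (simp add: proj_mat_def scalar_prod_def algebra_simps sum.distrib sum_distrib_left)
  qed
  moreover have "dim_vec (proj n us v) = n"
    using Cons.prems by (intro carrier_vecD proj_carrier) auto
  ultimately show ?case by (intro eq_vecI) (simp_all add: proj_mat_def)
qed

lemma scalar_prod_proj:
  assumes "set us \<subseteq> carrier_vec n" "w \<in> carrier_vec n"
  shows "scalar_prod w (proj n us v) = (\<Sum>u\<leftarrow>us. scalar_prod u v * scalar_prod u w)"
  using assms
  by (induction us) (auto simp: scalar_prod_add_distrib[of _ n] comm_scalar_prod[of w n])

lemma scalar_prod_proj_self:
  assumes "set us \<subseteq> carrier_vec n" "v \<in> carrier_vec n"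
  shows "scalar_prod v (proj n us v) = energy us v"
  using scalar_prod_proj[OF assms] by (simp add: energy_def power2_eq_square)

lemma scalar_prod_proj_orth:
  assumes "set us \<subseteq> carrier_vec n" "w \<in> carrier_vec n" "\<forall>u\<in>set us. scalar_prod u w = 0"
  shows "scalar_prod w (proj n us v) = 0"
  using assms by (induction us)
    (auto simp: scalar_prod_add_distrib[of _ n] comm_scalar_prod[of w n])

lemma orthon_proj:
  assumes "orthon n us" "w \<in> set us" "v \<in> carrier_vec n"
  shows "scalar_prod w (proj n us v) = scalar_prod w v"
  using assms
proof (induction us)
  case (Cons u us)
  note o = Cons.prems(1)[unfolded orthon_Cons]
  have us: "set us \<subseteq> carrier_vec n" using o orthon_carrier by blast
  have w: "w \<in> carrier_vec n" using Cons.prems orthon_carrier by blast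
  have *: "scalar_prod w (proj n (u # us) v) = scalar_prod u v * scalar_prod w u + scalar_prod w (proj n us v)"
    using o w us by (simp add: scalar_prod_add_distrib[of _ n])
  show ?case
  proof (cases "w = u")
    case True
    have "scalar_prod u (proj n us v) = 0"
    proof (intro scalar_prod_proj_orth ballI us)
      fix v assume "v \<in> set us"
      then have "v \<in> carrier_vec n" "scalar_prod u v = 0" using us o by auto
      then show "scalar_prod v u = 0" using o comm_scalar_prod[of v n u] by simp
    qed (use o in auto)
    with True o * show ?thesis by simp
  next
    case False
    then have "w \<in> set us" using Cons.prems by auto
    moreover have "scalar_prod w u = 0"
      using o \<open>w \<in> set us\<close> w by (metis comm_scalar_prod)
    ultimately show ?thesis using * Cons o by simp
  qed
qed simp

lemma resid_orth:
  assumes "orthon n us" "u \<in> set us" "v \<in> carrier_vec n"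
  shows "scalar_prod u (v - proj n us v) = 0"
proof -
  have "u \<in> carrier_vec n" "set us \<subseteq> carrier_vec n" using assms orthon_carrier by blast+
  then show ?thesis
    using orthon_proj[OF assms] assms(3) by (simp add: scalar_prod_minus_distrib[of _ n])
qed

section \<open>Spans of lists of columns\<close>

abbreviation col_span :: "nat \<Rightarrow> real Matrix.vec list \<Rightarrow> real Matrix.vec set" where
  "col_span n as \<equiv> vec_space.col_space n (mat_of_cols n as)"

lemma col_span_eq:
  assumes "set as \<subseteq> carrier_vec n"
  shows "col_span n as = {mat_of_cols n as *\<^sub>v c | c. c \<in> carrier_vec (length as)}"
proof -
  interpret vec_space "TYPE(real)" n .
  have "mat_of_cols n as *\<^sub>v c \<in> carrier_vec n" for c
    by (rule carrier_vecI) simp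
  then show ?thesis using col_space_eq[of "mat_of_cols n as" "length as"] by auto
qed

lemma col_span_carrier: "set as \<subseteq> carrier_vec n \<Longrightarrow> col_span n as \<subseteq> carrier_vec n"
  by (subst col_span_eq) (auto intro!: mult_mat_vec_carrier[of _ _ "length as"])

lemma col_span_add:
  assumes "set as \<subseteq> carrier_vec n" "v \<in> col_span n as" "w \<in> col_span n as"
  shows "v + w \<in> col_span n as"
proof -
  obtain c d where cd: "v = mat_of_cols n as *\<^sub>v c" "w = mat_of_cols n as *\<^sub>v d"
    "c \<in> carrier_vec (length as)" "d \<in> carrier_vec (length as)"
    using assms by (auto simp: col_span_eq)
  then have "v + w = mat_of_cols n as *\<^sub>v (c + d)"
    by (simp add: mult_add_distrib_mat_vec[of _ n "length as"])
  with cd show ?thesis using assms(1) by (auto simp: col_span_eq intro!: exI[of _ "c + d"])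
qed

lemma col_span_smult:
  assumes "set as \<subseteq> carrier_vec n" "v \<in> col_span n as"
  shows "r \<cdot>\<^sub>v v \<in> col_span n as"
proof -
  obtain c where c: "v = mat_of_cols n as *\<^sub>v c" "c \<in> carrier_vec (length as)"
    using assms by (auto simp: col_span_eq)
  then have "r \<cdot>\<^sub>v v = mat_of_cols n as *\<^sub>v (r \<cdot>\<^sub>v c)"
    by (simp add: mult_mat_vec[of _ n "length as"])
  with c show ?thesis using assms(1) by (auto simp: col_span_eq intro!: exI[of _ "r \<cdot>\<^sub>v c"])
qed

lemma col_span_zero: "set as \<subseteq> carrier_vec n \<Longrightarrow> 0\<^sub>v n \<in> col_span n as"
  by (auto simp: col_span_eq intro!: exI[of _ "0\<^sub>v (length as)"] eq_vecI)

lemma col_span_minus: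
  assumes "set as \<subseteq> carrier_vec n" "v \<in> col_span n as" "w \<in> col_span n as"
  shows "v - w \<in> col_span n as"
proof -
  have "v - w = v + (-1) \<cdot>\<^sub>v w"
    using assms col_span_carrier[OF assms(1)] by (intro eq_vecI) auto
  then show ?thesis using col_span_add[OF assms(1,2) col_span_smult[OF assms(1,3)]] by simp
qed

lemma col_span_base: 
  assumes "set as \<subseteq> carrier_vec n" "a \<in> set as"
  shows "a \<in> col_span n as"
proof -
  interpret vec_space "TYPE(real)" n .
  show ?thesis using assms span_mem[of "set as" a] by (simp add: col_space_def)
qed

lemma col_span_mono:
  assumes "set as \<subseteq> set bs" "set bs \<subseteq> carrier_vec n"
  shows "col_span n as \<subseteq> col_span n bs"
proof -
  interpret vec_space "TYPE(real)" n .
  show ?thesis using assms span_is_monotone[of "set as" "set bs"] by (simp add: col_space_def)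
qed

text \<open>An element of the span is A c, with A the matrix of the columns. Its inner product with
  \<open>v\<close> is that of A^T v with c, and the entries of A^T v are the inner products of
  \<open>v\<close> with the columns.\<close>

lemma col_span_orth:
  assumes "set as \<subseteq> carrier_vec n" "v \<in> carrier_vec n" "\<forall>a\<in>set as. scalar_prod v a = 0" "w \<in> col_span n as"
  shows "scalar_prod v w = 0"
proof -
  let ?A = "mat_of_cols n as"
  obtain c where c: "w = ?A *\<^sub>v c" "c \<in> carrier_vec (length as)"
    using assms by (auto simp: col_span_eq)
  have "?A\<^sup>T *\<^sub>v v = 0\<^sub>v (length as)"
  proof (intro eq_vecI)
    fix i assume i: "i < dim_vec (0\<^sub>v (length as) :: real Matrix.vec)"
    then have "as ! i \<in> set as" by simp
    then have "as ! i \<in> carrier_vec n" "scalar_prod v (as ! i) = 0" using assms by auto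
    then show "(?A\<^sup>T *\<^sub>v v) $ i = 0\<^sub>v (length as) $ i"
      using i assms by (simp add: col_mat_of_cols comm_scalar_prod[of _ n v])
  qed simp
  then have "scalar_prod (?A\<^sup>T *\<^sub>v v) c = 0" using c by simp
  then show ?thesis
    using c assms transpose_vec_mult_scalar[of ?A n "length as" c v] by simp
qed

lemma proj_in_col_span:
  assumes "set as \<subseteq> carrier_vec n" "set us \<subseteq> col_span n as"
  shows "proj n us v \<in> col_span n as"
  using assms by (induction us) (auto intro!: col_span_add col_span_smult col_span_zero)

section \<open>Orthonormal bases of column spans and uniqueness of the projection\<close>

text \<open>The last clause stands in for equality of spans: the orthogonal complement of
  \<open>us\<close> lies in that of \<open>as\<close>. In this form it passes directly through a
  Gram-Schmidt step and yields orthogonality of residuals without dimension arguments.\<close>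

definition onb_of :: "nat \<Rightarrow> real Matrix.vec list \<Rightarrow> real Matrix.vec list \<Rightarrow> bool" where
  "onb_of n as us \<longleftrightarrow> orthon n us \<and> set us \<subseteq> col_span n as \<and>
     (\<forall>v\<in>carrier_vec n. (\<forall>u\<in>set us. scalar_prod u v = 0) \<longrightarrow> (\<forall>a\<in>set as. scalar_prod v a = 0))"

text \<open>Extending a basis of the true model lists the additional columns last, while
  \<open>design_cols\<close> sorts all of them; only the set of columns matters.\<close>

lemma onb_of_cong: 
  assumes "set as = set bs" "set as \<subseteq> carrier_vec n"
  shows "onb_of n as us \<longleftrightarrow> onb_of n bs us"
proof -
  have "col_span n as = col_span n bs" using assms col_span_mono[of as bs n] col_span_mono[of bs as n] by auto
  then show ?thesis using assms(1) by (simp add: onb_of_def)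
qed

lemma onb_resid_orth:
  assumes "onb_of n as us" "set as \<subseteq> carrier_vec n" "v \<in> carrier_vec n" "w \<in> col_span n as"
  shows "scalar_prod (v - proj n us v) w = 0"
proof (rule col_span_orth[OF assms(2)])
  have us: "orthon n us" "set us \<subseteq> carrier_vec n"
    using assms(1) orthon_carrier by (auto simp: onb_of_def)
  show c: "v - proj n us v \<in> carrier_vec n" using us assms(3) by auto
  show "\<forall>a\<in>set as. scalar_prod (v - proj n us v) a = 0"
    using assms(1) c resid_orth[OF us(1) _ assms(3)] by (auto simp: onb_of_def)
qed fact

text \<open>The residual lies in the span and is orthogonal to it, hence to itself.\<close>

lemma onb_proj_id:
  assumes "onb_of n as us" "set as \<subseteq> carrier_vec n" "v \<in> col_span n as"
  shows "v - proj n us v = 0\<^sub>v n"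
proof -
  have v: "v \<in> carrier_vec n" using assms col_span_carrier by blast
  have us: "set us \<subseteq> col_span n as" "set us \<subseteq> carrier_vec n"
    using assms(1) orthon_carrier by (auto simp: onb_of_def)
  have "v - proj n us v \<in> col_span n as"
    using assms us by (intro col_span_minus proj_in_col_span) auto
  from onb_resid_orth[OF assms(1,2) v this] show ?thesis
    by (rule scalar_prod_self_eq_0D) (use v us in auto)
qed

text \<open>For each vector the difference of the two images lies in the span and is orthogonal to
  it. Uniqueness is what evaluates the definite description in \<open>hat_mat\<close>.\<close>

lemma is_orth_proj_unique:
  assumes as: "set as \<subseteq> carrier_vec n"
    and "is_orth_proj n (col_span n as) H" "is_orth_proj n (col_span n as) H'"
  shows "H = H'"
proof -
  have H: "H \<in> carrier_mat n n" "H' \<in> carrier_mat n n" using assms by (auto simp: is_orth_proj_def)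
  have eq: "H *\<^sub>v v = H' *\<^sub>v v" if v: "v \<in> carrier_vec n" for v
  proof -
    define w where "w = H *\<^sub>v v - H' *\<^sub>v v"
    have Hv: "H *\<^sub>v v \<in> carrier_vec n" "H' *\<^sub>v v \<in> carrier_vec n" using H v by auto
    have w: "w \<in> col_span n as" using assms v unfolding w_def by (intro col_span_minus) (auto simp: is_orth_proj_def)
    have wc: "w \<in> carrier_vec n" using Hv by (simp add: w_def)
    have "scalar_prod (v - H *\<^sub>v v) w = 0" "scalar_prod (v - H' *\<^sub>v v) w = 0"
      using assms v w by (auto simp: is_orth_proj_def)
    then have "scalar_prod (H *\<^sub>v v) w = scalar_prod (H' *\<^sub>v v) w"
      using v Hv wc by (simp add: minus_scalar_prod_distrib[of _ n])
    then have "scalar_prod w w = 0"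
      using Hv wc by (subst (1) w_def) (simp add: minus_scalar_prod_distrib[of _ n])
    then have "w = 0\<^sub>v n" using wc by (rule scalar_prod_self_eq_0D)
    show ?thesis
    proof (intro eq_vecI)
      fix i assume "i < dim_vec (H' *\<^sub>v v)"
      then have i: "i < n" "i < dim_row H'" using H by auto
      have "w $ i = 0" using \<open>w = 0\<^sub>v n\<close> i by simp
      then show "(H *\<^sub>v v) $ i = (H' *\<^sub>v v) $ i"
        unfolding w_def using i Hv by (subst (asm) index_minus_vec) auto
    qed (use H in auto)
  qed
  show ?thesis
  proof (intro eq_matI)
    fix i j assume "i < dim_row H'" "j < dim_col H'"
    then have ij: "i < n" "j < n" "i < dim_row H" "j < dim_col H" "i < dim_row H'" "j < dim_col H'"
      using H by auto
    have "(H *\<^sub>v unit_vec n j) $ i = H $$ (i, j)" "(H' *\<^sub>v unit_vec n j) $ i = H' $$ (i, j)"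
      using ij H by (simp_all add: scalar_prod_right_unit[of j n])
    then show "H $$ (i, j) = H' $$ (i, j)" using eq[of "unit_vec n j"] by simp
  qed (use H in auto)
qed

lemma proj_mat_is_orth_proj:
  assumes "onb_of n as us" "set as \<subseteq> carrier_vec n"
  shows "is_orth_proj n (col_span n as) (proj_mat n us)"
proof -
  have us: "set us \<subseteq> col_span n as" "set us \<subseteq> carrier_vec n"
    using assms(1) orthon_carrier by (auto simp: onb_of_def)
  show ?thesis
    using onb_resid_orth[OF assms] proj_in_col_span[OF assms(2) us(1)] proj_mat_mult_vec[OF us(2)]
    by (auto simp: is_orth_proj_def) (auto simp: proj_mat_def)
qed

text \<open>Gram-Schmidt started from a given basis. Keeping \<open>us\<close> as a prefix lets the
  bases of nested models share it, and the bound on \<open>length vs\<close> limits the degrees of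
  freedom gained by the added columns, which may be linearly dependent.\<close>

lemma onb_extend:
  assumes "onb_of n as us" "set (as @ bs) \<subseteq> carrier_vec n"
  shows "\<exists>vs. length vs \<le> length bs \<and> onb_of n (as @ bs) (us @ vs)"
  using assms(2)
proof (induction bs rule: rev_induct)
  case Nil
  then show ?case using assms(1) by auto
next
  case (snoc b bs)
  then obtain vs where vs: "length vs \<le> length bs" "onb_of n (as @ bs) (us @ vs)" by auto
  define ws where "ws = us @ vs"
  define cl where "cl = as @ bs"
  have b: "b \<in> carrier_vec n" and cl: "set cl \<subseteq> carrier_vec n" "set (cl @ [b]) \<subseteq> carrier_vec n"
    using snoc by (auto simp: cl_def)
  have o: "onb_of n cl ws" using vs by (simp add: ws_def cl_def)
  have ws: "orthon n ws" "set ws \<subseteq> col_span n cl" "set ws \<subseteq> carrier_vec n"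
    using o orthon_carrier by (auto simp: onb_of_def)
  define r where "r = b - proj n ws b"
  have r: "r \<in> carrier_vec n" using b ws by (simp add: r_def)
  have mono: "col_span n cl \<subseteq> col_span n (cl @ [b])" using cl by (intro col_span_mono) auto
  \<comment> \<open>As \<open>b\<close> is \<open>r\<close> plus a combination of \<open>ws\<close>,
    orthogonality to \<open>r\<close> and \<open>ws\<close> implies orthogonality to
    \<open>b\<close>; this carries the last clause of \<open>onb_of\<close> over to the new
    column.\<close>
  have rb: "scalar_prod v b = 0" if v: "v \<in> carrier_vec n" "scalar_prod r v = 0" "\<forall>u\<in>set ws. scalar_prod u v = 0" for v
  proof -
    have "scalar_prod v r = scalar_prod v b - scalar_prod v (proj n ws b)"
      unfolding r_def using v b ws by (simp add: scalar_prod_minus_distrib[of _ n])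
    moreover have "scalar_prod v (proj n ws b) = 0"
      using v ws by (intro scalar_prod_proj_orth) auto
    ultimately show ?thesis using v(2) comm_scalar_prod[OF v(1) r] by simp
  qed
  show ?case
  proof (cases "r = 0\<^sub>v n")
    case True
    \<comment> \<open>A column that depends on the earlier ones adds no vector; this is why the
      length bound is only an inequality.\<close>
    have "onb_of n (cl @ [b]) ws"
      using o mono rb True unfolding onb_of_def by auto
    then show ?thesis using vs(1) by (intro exI[of _ vs]) (simp add: ws_def cl_def)
  next
    case False
    define u where "u = (1 / sqrt (scalar_prod r r)) \<cdot>\<^sub>v r"
    have rr: "scalar_prod r r > 0"
      using False r scalar_prod_self_eq_0D[of r n] scalar_prod_self_nonneg[of r] by fastforce
    have u: "u \<in> carrier_vec n" using r by (simp add: u_def)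
    have uu: "scalar_prod u u = 1" using rr r by (simp add: u_def)
    have wu: "scalar_prod w u = 0" if "w \<in> set ws" for w
      using resid_orth[OF ws(1) that b] that ws r by (auto simp: u_def r_def[symmetric])
    have "r \<in> col_span n (cl @ [b])"
      unfolding r_def using cl ws mono
      by (intro col_span_minus proj_in_col_span col_span_base) auto
    then have u_in: "u \<in> col_span n (cl @ [b])" unfolding u_def using cl by (intro col_span_smult) auto
    have "onb_of n (cl @ [b]) (ws @ [u])"
      unfolding onb_of_def
    proof (intro conjI ballI impI)
      show "orthon n (ws @ [u])" using ws u uu wu by (simp add: orthon_append) (simp add: orthon_def)
      show "set (ws @ [u]) \<subseteq> col_span n (cl @ [b])" using ws mono u_in by auto
    next
      fix v a assume v: "v \<in> carrier_vec n" "\<forall>u\<in>set (ws @ [u]). scalar_prod u v = 0" "a \<in> set (cl @ [b])"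
      then have "scalar_prod r v = 0" using rr r by (auto simp: u_def)
      then show "scalar_prod v a = 0" using v rb o unfolding onb_of_def by auto
    qed
    then show ?thesis using vs(1) by (intro exI[of _ "vs @ [u]"]) (simp add: ws_def cl_def)
  qed
qed

lemma onb_exists:
  assumes "set as \<subseteq> carrier_vec n"
  shows "\<exists>us. length us \<le> length as \<and> onb_of n as us"
proof -
  have "onb_of n [] []" by (auto simp: onb_of_def orthon_def)
  from onb_extend[OF this, of as] assms show ?thesis by auto
qed


section \<open>Residual sums of squares in orthonormal bases\<close>

definition design_cols :: "nat \<Rightarrow> (nat \<Rightarrow> nat \<Rightarrow> real) \<Rightarrow> nat set \<Rightarrow> real Matrix.vec list" where
  "design_cols n x s = Matrix.vec n (\<lambda>_. 1) # map (design_col n x) (sorted_list_of_set s)"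

lemma design_cols_carrier: "set (design_cols n x s) \<subseteq> carrier_vec n"
  by (auto simp: design_cols_def design_col_def)

lemma length_design_cols: "length (design_cols n x s) = Suc (card s)"
  by (simp add: design_cols_def)

lemma hat_mat_eq:
  assumes "onb_of n (design_cols n x s) us"
  shows "hat_mat n x s = proj_mat n us"
  unfolding hat_mat_def design_mat_def design_cols_def[symmetric]
  using proj_mat_is_orth_proj[OF assms design_cols_carrier] is_orth_proj_unique[OF design_cols_carrier]
  by (intro the_equality) auto

lemma RSS_eq:
  assumes "onb_of n (design_cols n x s) us" "y \<in> carrier_vec n"
  shows "RSS n x y s = scalar_prod y y - energy us y"
proof -
  have us: "set us \<subseteq> carrier_vec n" using assms(1) orthon_carrier by (auto simp: onb_of_def)
  have "proj_mat n us \<in> carrier_mat n n" by (simp add: proj_mat_def)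
  then have "(1\<^sub>m n - hat_mat n x s) *\<^sub>v y = y - proj n us y"
    using assms(2) us
    by (simp add: hat_mat_eq[OF assms(1)] minus_mult_distrib_mat_vec[of _ n n] proj_mat_mult_vec)
  then show ?thesis
    using assms(2) us by (simp add: RSS_def scalar_prod_minus_distrib[of _ n] scalar_prod_proj_self)
qed

lemma energy_add:
  assumes "set us \<subseteq> carrier_vec n" "v \<in> carrier_vec n" "w \<in> carrier_vec n"
  shows "energy us (v + w) =
    energy us v + 2 * (\<Sum>u\<leftarrow>us. scalar_prod u v * scalar_prod u w) + energy us w"
  using assms
  by (induction us) (auto simp: scalar_prod_add_distrib[of _ n] power2_eq_square algebra_simps)

text \<open>The expansion of y^T (I - H) y at y = v + e. Since I - H is symmetric and idempotent,
  \<open>v\<close> enters only through its residual \<open>m\<close>, in the quadratic term as well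
  as in the cross term.\<close>

lemma RSS_add:
  fixes m :: "real Matrix.vec"
  assumes "onb_of n (design_cols n x s) us" "v \<in> carrier_vec n" "e \<in> carrier_vec n"
  defines "m \<equiv> v - proj n us v"
  shows "RSS n x (v + e) s = scalar_prod m m + 2 * scalar_prod m e + scalar_prod e e - energy us e"
proof -
  let ?P = "proj n us v"
  have o: "orthon n us" and us: "set us \<subseteq> carrier_vec n"
    using assms(1) orthon_carrier by (auto simp: onb_of_def)
  have P: "?P \<in> carrier_vec n" and m: "m \<in> carrier_vec n" using us assms by (auto simp: m_def)
  have "scalar_prod m ?P = 0"
    using us m resid_orth[OF o _ assms(2)] unfolding m_def by (intro scalar_prod_proj_orth) auto
  moreover have "scalar_prod m m = scalar_prod m v - scalar_prod m ?P"
    using m P assms(2) by (subst (2) m_def) (simp add: scalar_prod_minus_distrib[of _ n])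
  moreover have "scalar_prod m v = scalar_prod v v - energy us v"
    unfolding m_def using P assms(2) us
    by (simp add: minus_scalar_prod_distrib[of _ n] comm_scalar_prod[OF P] scalar_prod_proj_self)
  ultimately have mm: "scalar_prod m m = scalar_prod v v - energy us v" by simp
  have "scalar_prod m e = scalar_prod v e - scalar_prod e ?P"
    unfolding m_def using P assms(2,3)
    by (simp add: minus_scalar_prod_distrib[of _ n] comm_scalar_prod[OF P])
  then have me: "scalar_prod m e = scalar_prod v e - (\<Sum>u\<leftarrow>us. scalar_prod u v * scalar_prod u e)"
    using scalar_prod_proj[OF us assms(3)] by simp
  have "scalar_prod (v + e) (v + e) = scalar_prod v v + 2 * scalar_prod v e + scalar_prod e e"
    using assms(2,3) comm_scalar_prod[OF assms(2,3)]
    by (simp add: scalar_prod_add_distrib[of _ n] add_scalar_prod_distrib[of _ n])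
  then show ?thesis
    using RSS_eq[OF assms(1), of "v + e"] energy_add[OF us assms(2,3)] mm me assms(2,3) by simp
qed

lemma mean_vec_in_col_span:
  "mean_vec n p x b \<in> col_span n (design_cols n x (true_model p b))"
proof -
  have "coef_vec b (true_model p b) \<in> carrier_vec (length (design_cols n x (true_model p b)))"
    by (rule carrier_vecI) (simp add: coef_vec_def length_design_cols)
  then show ?thesis
    by (subst col_span_eq[OF design_cols_carrier]) (auto simp: mean_vec_def design_mat_def design_cols_def)
qed

lemma mean_vec_carrier: "mean_vec n p x b \<in> carrier_vec n"
  using mean_vec_in_col_span col_span_carrier[OF design_cols_carrier] by blast

lemma finite_true_model [simp]: "finite (true_model p b)"
  by (simp add: true_model_def)

text \<open>Predictors outside the true model have coefficient zero, so the true model alone already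
  gives the full linear predictor.\<close>

lemma mean_vec_index:
  assumes "i < n"
  shows "mean_vec n p x b $ i = b 0 + (\<Sum>j = 1..p. b j * x (Suc i) j)"
proof -
  define s where "s = true_model p b"
  define L where "L = sorted_list_of_set s"
  have fin: "finite s" by (simp add: s_def)
  have "mean_vec n p x b $ i =
      (\<Sum>l<Suc (length L). (design_cols n x s ! l) $ i * (b 0 # map b L) ! l)"
    using assms unfolding mean_vec_def coef_vec_def s_def[symmetric] L_def[symmetric] design_mat_def
    by (simp add: design_cols_def L_def[symmetric] scalar_prod_def mat_of_cols_index
          atLeast0LessThan vec_of_list_index
          del: sum.lessThan_Suc vec_of_list_Cons vec_of_list_map)
  also have "\<dots> = b 0 + (\<Sum>l<length L. x (Suc i) (L ! l) * b (L ! l))"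
    using assms by (subst sum.lessThan_Suc_shift) (simp add: design_cols_def L_def[symmetric] design_col_def)
  also have "(\<Sum>l<length L. x (Suc i) (L ! l) * b (L ! l)) = (\<Sum>j\<leftarrow>L. b j * x (Suc i) j)"
    by (simp add: sum_list_sum_nth atLeast0LessThan mult.commute)
  also have "\<dots> = (\<Sum>j\<in>s. b j * x (Suc i) j)"
    using fin by (simp add: L_def sum_list_distinct_conv_sum_set)
  also have "\<dots> = (\<Sum>j = 1..p. b j * x (Suc i) j)"
    by (rule sum.mono_neutral_left) (auto simp: s_def true_model_def)
  finally show ?thesis .
qed

lemma response_eq: "response n p x b e = mean_vec n p x b + Matrix.vec n (\<lambda>i. e (Suc i))"
  using mean_vec_carrier[of n p x b]
  by (intro eq_vecI) (auto simp: response_def mean_vec_index)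

lemma eucl_norm_sq: "(eucl_norm v)\<^sup>2 = scalar_prod v v"
  by (simp add: eucl_norm_def L2_set_def scalar_prod_self sum_nonneg)

lemma Delta_eq:
  fixes p :: nat and b :: "nat \<Rightarrow> real"
  assumes "onb_of n (design_cols n x s) us"
  defines "m \<equiv> mean_vec n p x b - proj n us (mean_vec n p x b)"
  shows "Delta n p x b s = scalar_prod m m"
proof -
  have "set us \<subseteq> carrier_vec n" using assms(1) orthon_carrier by (auto simp: onb_of_def)
  then show ?thesis
    by (simp add: Delta_def m_def eucl_norm_sq hat_mat_eq[OF assms(1)] proj_mat_mult_vec mean_vec_carrier)
qed

text \<open>The mean leaves a cross term, twice the inner product of its residual with the noise.
  The unit vector in the direction of the residual is orthogonal to the basis of the model and is
  appended to it, so that one energy controls both noise terms. The 2 in \<open>card s + 2\<close>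
  counts the intercept and this vector.\<close>

lemma RSS_lower_bound:
  obtains vs where "orthon n vs" "length vs \<le> card s + 2"
    "\<And>e. e \<in> carrier_vec n \<Longrightarrow> RSS n x (mean_vec n p x b + e) s \<ge>
       Delta n p x b s - 2 * sqrt (Delta n p x b s) * sqrt (energy vs e) + scalar_prod e e - energy vs e"
proof -
  obtain us where us: "length us \<le> Suc (card s)" "onb_of n (design_cols n x s) us"
    using onb_exists[OF design_cols_carrier, of n x s] by (auto simp: length_design_cols)
  have o: "orthon n us" using us by (auto simp: onb_of_def)
  define mu where "mu = mean_vec n p x b"
  define m where "m = mu - proj n us mu"
  have mu: "mu \<in> carrier_vec n" by (simp add: mu_def mean_vec_carrier)
  have m: "m \<in> carrier_vec n" using mu orthon_carrier[OF o] by (simp add: m_def)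
  have D: "Delta n p x b s = scalar_prod m m"
    using Delta_eq[OF us(2)] by (simp add: m_def mu_def)
  note R = RSS_add[OF us(2) mu, folded m_def]
  show ?thesis
  proof (cases "m = 0\<^sub>v n")
    case True
    then show ?thesis
      using that[of us] us o R D by (simp add: mu_def)
  next
    case False
    then have mm: "scalar_prod m m > 0"
      using m scalar_prod_self_eq_0D[of m n] scalar_prod_self_nonneg[of m] by fastforce
    define w where "w = (1 / sqrt (scalar_prod m m)) \<cdot>\<^sub>v m"
    have w: "w \<in> carrier_vec n" "scalar_prod w w = 1" using m mm by (auto simp: w_def)
    have "scalar_prod u w = 0" if "u \<in> set us" for u
      using resid_orth[OF o that mu] that orthon_carrier[OF o] m by (auto simp: w_def m_def[symmetric])
    then have o': "orthon n (us @ [w])" using o w by (simp add: orthon_append) (simp add: orthon_def)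
    have "RSS n x (mu + e) s \<ge> scalar_prod m m - 2 * sqrt (scalar_prod m m) * sqrt (energy (us @ [w]) e)
          + scalar_prod e e - energy (us @ [w]) e" if e: "e \<in> carrier_vec n" for e
    proof -
      have "scalar_prod m e = sqrt (scalar_prod m m) * scalar_prod w e"
        using mm m e by (simp add: w_def)
      moreover have "- scalar_prod w e \<le> sqrt (energy (us @ [w]) e)"
        using energy_nonneg[of us e] by (intro real_le_rsqrt) simp
      then have "sqrt (scalar_prod m m) * (- scalar_prod w e)
          \<le> sqrt (scalar_prod m m) * sqrt (energy (us @ [w]) e)"
        using mm by (intro mult_left_mono) auto
      moreover have "energy us e \<le> energy (us @ [w]) e" by simp
      ultimately show ?thesis using R[OF e] unfolding mult.assoc by linarith
    qed
    then show ?thesis using that[OF o'] us(1) D by (simp add: mu_def)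
  qed
qed

text \<open>Both spans contain the mean, so its residual vanishes in both models. What is left of
  the difference is the noise energy of the vectors by which a basis of the true model is extended
  to one of \<open>s\<close>. Taken with \<open>s\<close> equal to the true model, the last
  conclusion covers that model itself.\<close>

lemma RSS_overfit:
  assumes "true_model p b \<subseteq> s" "finite s"
  obtains vs where "orthon n vs" "length vs \<le> card (s - true_model p b)"
    "\<And>e. e \<in> carrier_vec n \<Longrightarrow> RSS n x (mean_vec n p x b + e) (true_model p b)
       - RSS n x (mean_vec n p x b + e) s = energy vs e"
    "Delta n p x b s = 0"
proof -
  define s0 where "s0 = true_model p b"
  define mu where "mu = mean_vec n p x b"
  define bs where "bs = map (design_col n x) (sorted_list_of_set (s - s0))"
  have mu: "mu \<in> carrier_vec n" by (simp add: mu_def mean_vec_carrier)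
  have sub: "s0 \<subseteq> s" "finite s" "finite s0" using assms by (auto simp: s0_def)
  have cl: "set (design_cols n x s0 @ bs) = set (design_cols n x s)"
    using sub by (auto simp: design_cols_def bs_def)
  obtain us where us: "onb_of n (design_cols n x s0) us"
    using onb_exists[OF design_cols_carrier, of n x s0] by auto
  obtain vs where vs: "length vs \<le> length bs" "onb_of n (design_cols n x s0 @ bs) (us @ vs)"
    using onb_extend[OF us, of bs] design_cols_carrier by (metis cl)
  have vs': "onb_of n (design_cols n x s) (us @ vs)"
    using vs(2) onb_of_cong[OF cl] cl design_cols_carrier by metis
  have mu0: "mu \<in> col_span n (design_cols n x s0)" by (simp add: mu_def s0_def mean_vec_in_col_span)
  have "col_span n (design_cols n x s0) \<subseteq> col_span n (design_cols n x s)"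
    using cl design_cols_carrier by (intro col_span_mono) auto
  then have mus: "mu \<in> col_span n (design_cols n x s)" using mu0 by blast
  note r0 = onb_proj_id[OF us design_cols_carrier mu0] and rs = onb_proj_id[OF vs' design_cols_carrier mus]
  have "orthon n vs" using vs' by (auto simp: onb_of_def orthon_append)
  moreover have "length vs \<le> card (s - s0)" using vs(1) by (simp add: bs_def)
  moreover have "RSS n x (mu + e) s0 - RSS n x (mu + e) s = energy vs e" if "e \<in> carrier_vec n" for e
    using RSS_add[OF us mu that] RSS_add[OF vs' mu that] that by (simp add: r0 rs)
  moreover have "Delta n p x b s = 0"
    using Delta_eq[OF vs', where p = p and b = b] rs by (simp add: mu_def)
  ultimately show ?thesis using that by (simp add: s0_def mu_def)
qed

lemma RSS_true_le:
  assumes "e \<in> carrier_vec n"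
  shows "RSS n x (mean_vec n p x b + e) (true_model p b) \<le> scalar_prod e e"
proof -
  obtain us where us: "onb_of n (design_cols n x (true_model p b)) us"
    using onb_exists[OF design_cols_carrier, of n x] by auto
  have mu: "mean_vec n p x b \<in> carrier_vec n" by (rule mean_vec_carrier)
  show ?thesis
    using RSS_add[OF us mu assms] onb_proj_id[OF us design_cols_carrier mean_vec_in_col_span]
      assms energy_nonneg[of us e] by simp
qed

section \<open>Projections of Gaussian noise\<close>

lemma nn_integral_normal_density:
  assumes "0 < s"
  shows "(\<integral>\<^sup>+x. ennreal (normal_density m s x) \<partial>lborel) = 1"
  using assms by (subst nn_integral_eq_integral) auto

text \<open>Completing the square turns the integrand into a multiple of the N(a, 1)
  density.\<close>

lemma std_normal_mgf:
  "(\<integral>\<^sup>+x. ennreal (std_normal_density x) * ennreal (exp (a * x)) \<partial>lborel) = ennreal (exp (a\<^sup>2 / 2))"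
proof -
  have "std_normal_density x * exp (a * x) = exp (a\<^sup>2 / 2) * normal_density a 1 x" for x
    by (simp add: normal_density_def flip: exp_add) (simp add: power2_eq_square field_simps)
  then have "(\<integral>\<^sup>+x. ennreal (std_normal_density x) * ennreal (exp (a * x)) \<partial>lborel)
      = (\<integral>\<^sup>+x. ennreal (exp (a\<^sup>2 / 2)) * ennreal (normal_density a 1 x) \<partial>lborel)"
    by (intro nn_integral_cong) (simp flip: ennreal_mult')
  then show ?thesis by (simp add: nn_integral_cmult nn_integral_normal_density)
qed

text \<open>The integrand is a multiple of the centred normal density with variance 1 / (1 - 2 l).
  Negative \<open>l\<close> is included and serves for the lower tail of the squared norm.\<close>

lemma std_normal_square_mgf:
  assumes "l < 1 / 2"
  shows "(\<integral>\<^sup>+x. ennreal (std_normal_density x) * ennreal (exp (l * x\<^sup>2)) \<partial>lborel)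
    = ennreal (1 / sqrt (1 - 2 * l))"
proof -
  define d where "d = sqrt (1 - 2 * l)"
  have d: "d > 0" "d\<^sup>2 = 1 - 2 * l" using assms by (auto simp: d_def)
  have "std_normal_density x * exp (l * x\<^sup>2) = (1 / d) * normal_density 0 (1 / d) x" for x
  proof -
    have "- (x\<^sup>2 / 2) + l * x\<^sup>2 = - (d\<^sup>2 * x\<^sup>2 / 2)" unfolding d(2) by (simp add: field_simps)
    then have "exp (- (x\<^sup>2 / 2)) * exp (l * x\<^sup>2) = exp (- (d\<^sup>2 * x\<^sup>2 / 2))" by (simp flip: exp_add)
    moreover have "sqrt (2 * pi * (1 / d)\<^sup>2) = sqrt (2 * pi) / d"
      using d(1) by (simp add: real_sqrt_mult real_sqrt_divide power_divide)
    ultimately show ?thesis using d(1)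
      by (simp add: normal_density_def power_divide mult.commute)
  qed
  then have "(\<integral>\<^sup>+x. ennreal (std_normal_density x) * ennreal (exp (l * x\<^sup>2)) \<partial>lborel)
      = (\<integral>\<^sup>+x. ennreal (1 / d) * ennreal (normal_density 0 (1 / d) x) \<partial>lborel)"
    using d by (intro nn_integral_cong) (simp flip: ennreal_mult')
  then show ?thesis using d(1) by (simp add: nn_integral_cmult nn_integral_normal_density d_def[symmetric])
qed

section \<open>The noise vector, divided by its standard deviation, at one sample size\<close>

locale std_gaussian = prob_space +
  fixes X :: "nat \<Rightarrow> 'a \<Rightarrow> real" and n :: nat
  assumes indep: "indep_vars (\<lambda>_. borel) X {1..n}"
    and dist: "\<And>i. i \<in> {1..n} \<Longrightarrow> distributed M lborel (X i) std_normal_density"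
begin

definition Z :: "'a \<Rightarrow> real Matrix.vec" where
  "Z \<omega> = Matrix.vec n (\<lambda>i. X (Suc i) \<omega>)"

lemma Z_carrier [simp]: "Z \<omega> \<in> carrier_vec n"
  by (simp add: Z_def)

lemma X_measurable [measurable]: "i \<in> {1..n} \<Longrightarrow> X i \<in> borel_measurable M"
  using indep by (auto simp: indep_vars_def)

lemma scalar_prod_Z: "scalar_prod v (Z \<omega>) = (\<Sum>i\<in>{1..n}. v $ (i - 1) * X i \<omega>)"
  by (simp add: scalar_prod_def Z_def atLeast0LessThan sum.atLeast1_atMost_eq)

lemma scalar_prod_Z_self: "scalar_prod (Z \<omega>) (Z \<omega>) = (\<Sum>i\<in>{1..n}. (X i \<omega>)\<^sup>2)"
  by (simp add: scalar_prod_def Z_def atLeast0LessThan sum.atLeast1_atMost_eq power2_eq_square)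

lemma scalar_prod_Z_measurable [measurable]: "(\<lambda>\<omega>. scalar_prod v (Z \<omega>)) \<in> borel_measurable M"
  unfolding scalar_prod_Z by measurable

lemma scalar_prod_Z_self_measurable [measurable]:
  "(\<lambda>\<omega>. scalar_prod (Z \<omega>) (Z \<omega>)) \<in> borel_measurable M"
  unfolding scalar_prod_Z_self by measurable

lemma energy_Z_measurable [measurable]: "(\<lambda>\<omega>. energy us (Z \<omega>)) \<in> borel_measurable M"
  by (induction us) simp_all

text \<open>Independence turns the integral of a product of exponentials into a product of
  one-dimensional integrals.\<close>

lemma nn_integral_exp_sum:
  assumes [measurable]: "\<And>i. f i \<in> borel_measurable borel"
  shows "(\<integral>\<^sup>+\<omega>. ennreal (exp (\<Sum>i\<in>{1..n}. f i (X i \<omega>))) \<partial>M)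
    = (\<Prod>i\<in>{1..n}. \<integral>\<^sup>+x. ennreal (std_normal_density x) * ennreal (exp (f i x)) \<partial>lborel)"
proof -
  have "(\<integral>\<^sup>+\<omega>. ennreal (exp (\<Sum>i\<in>{1..n}. f i (X i \<omega>))) \<partial>M)
      = (\<integral>\<^sup>+\<omega>. (\<Prod>i\<in>{1..n}. ennreal (exp (f i (X i \<omega>)))) \<partial>M)"
    by (simp add: exp_sum prod_ennreal)
  also have "\<dots> = (\<Prod>i\<in>{1..n}. \<integral>\<^sup>+\<omega>. ennreal (exp (f i (X i \<omega>))) \<partial>M)"
    by (intro indep_vars_nn_integral indep_vars_compose2[OF indep]) auto
  also have "\<dots> = (\<Prod>i\<in>{1..n}. \<integral>\<^sup>+x. ennreal (std_normal_density x) * ennreal (exp (f i x)) \<partial>lborel)"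
    by (intro prod.cong refl distributed_nn_integral[OF dist, symmetric]) auto
  finally show ?thesis .
qed

lemma nn_integral_exp_scalar_prod:
  assumes "v \<in> carrier_vec n"
  shows "(\<integral>\<^sup>+\<omega>. ennreal (exp (scalar_prod v (Z \<omega>))) \<partial>M) = ennreal (exp (scalar_prod v v / 2))"
proof -
  have "(\<integral>\<^sup>+\<omega>. ennreal (exp (scalar_prod v (Z \<omega>))) \<partial>M) = (\<Prod>i\<in>{1..n}. ennreal (exp ((v $ (i - 1))\<^sup>2 / 2)))"
    unfolding scalar_prod_Z by (subst nn_integral_exp_sum) (auto simp: std_normal_mgf)
  also have "\<dots> = ennreal (exp (\<Sum>i\<in>{1..n}. (v $ (i - 1))\<^sup>2 / 2))"
    by (simp add: exp_sum prod_ennreal)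
  also have "(\<Sum>i\<in>{1..n}. (v $ (i - 1))\<^sup>2 / 2) = scalar_prod v v / 2"
    using assms by (simp add: scalar_prod_self sum.atLeast1_atMost_eq sum_divide_distrib)
  finally show ?thesis .
qed

lemma nn_integral_exp_norm:
  assumes "l < 1 / 2"
  shows "(\<integral>\<^sup>+\<omega>. ennreal (exp (l * scalar_prod (Z \<omega>) (Z \<omega>))) \<partial>M) = ennreal ((1 / sqrt (1 - 2 * l)) ^ n)"
  unfolding scalar_prod_Z_self sum_distrib_left
  using assms by (subst nn_integral_exp_sum) (auto simp: std_normal_square_mgf ennreal_power)

text \<open>A square in the exponent is linearised by an auxiliary Gaussian integral,
  \<open>exp (l * y\<^sup>2) = E (exp (sqrt (2 * l) * g * y))\<close>, which absorbs one more
  vector of the orthonormal list into the vector \<open>v\<close>.\<close>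

lemma nn_integral_exp_energy:
  assumes "orthon n us" "v \<in> carrier_vec n" "\<forall>u\<in>set us. scalar_prod u v = 0" "0 \<le> l" "l < 1 / 2"
  shows "(\<integral>\<^sup>+\<omega>. ennreal (exp (l * energy us (Z \<omega>) + scalar_prod v (Z \<omega>))) \<partial>M)
    = ennreal ((1 / sqrt (1 - 2 * l)) ^ length us * exp (scalar_prod v v / 2))"
  using assms(1-3)
proof (induction us arbitrary: v)
  case Nil
  then show ?case by (simp add: nn_integral_exp_scalar_prod)
next
  case (Cons u us)
  define C where "C = 1 / sqrt (1 - 2 * l)"
  have C: "C \<ge> 0" using assms by (simp add: C_def)
  define a where "a = sqrt (2 * l)"
  have a: "a\<^sup>2 = 2 * l" using assms by (simp add: a_def)
  have o: "orthon n us" "u \<in> carrier_vec n" "scalar_prod u u = 1" "\<forall>w\<in>set us. scalar_prod u w = 0"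
    using Cons.prems(1) by (auto simp: orthon_Cons)
  have v: "v \<in> carrier_vec n" "scalar_prod u v = 0" "\<forall>w\<in>set us. scalar_prod w v = 0"
    using Cons.prems by auto
  define y where "y g = v + (a * g) \<cdot>\<^sub>v u" for g
  have y: "y g \<in> carrier_vec n" for g using o v by (simp add: y_def)
  have yu: "\<forall>w\<in>set us. scalar_prod w (y g) = 0" for g
  proof
    fix w assume w: "w \<in> set us"
    then have "w \<in> carrier_vec n" using o orthon_carrier by blast
    then show "scalar_prod w (y g) = 0"
      using w o v comm_scalar_prod[of w n u] by (simp add: y_def scalar_prod_add_distrib[of _ n])
  qed
  \<comment> \<open>The vector \<open>u\<close> has norm 1 and is orthogonal to \<open>v\<close>, so
    the squared norm grows by \<open>2 * l * g^2\<close>. After the induction hypothesis the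
    integral over \<open>g\<close> is therefore that of \<open>exp (l * g^2)\<close>, which supplies
    the new factor \<open>C\<close>.\<close>
  have yy: "scalar_prod (y g) (y g) = scalar_prod v v + 2 * (l * g\<^sup>2)" for g
    using o v comm_scalar_prod[OF v(1) o(2)] a
    by (simp add: y_def scalar_prod_add_distrib[of _ n] add_scalar_prod_distrib[of _ n] power2_eq_square
        algebra_simps)
  have yZ: "scalar_prod (y g) (Z \<omega>) = scalar_prod v (Z \<omega>) + (a * scalar_prod u (Z \<omega>)) * g" for g \<omega>
    using o v by (simp add: y_def add_scalar_prod_distrib[of _ n] algebra_simps)
  define F where "F \<omega> g = ennreal (std_normal_density g)
    * ennreal (exp (l * energy us (Z \<omega>) + scalar_prod (y g) (Z \<omega>)))" for \<omega> g
  have [measurable]: "case_prod F \<in> borel_measurable (M \<Otimes>\<^sub>M lborel)"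
    unfolding F_def yZ split_beta' by measurable
  interpret P: pair_sigma_finite M lborel ..
  have "(\<integral>\<^sup>+\<omega>. ennreal (exp (l * energy (u # us) (Z \<omega>) + scalar_prod v (Z \<omega>))) \<partial>M)
      = (\<integral>\<^sup>+\<omega>. \<integral>\<^sup>+g. F \<omega> g \<partial>lborel \<partial>M)"
  proof (intro nn_integral_cong)
    fix \<omega>
    define c where "c = l * energy us (Z \<omega>) + scalar_prod v (Z \<omega>)"
    define t where "t = scalar_prod u (Z \<omega>)"
    have "(\<integral>\<^sup>+g. F \<omega> g \<partial>lborel)
        = (\<integral>\<^sup>+g. ennreal (exp c) * (ennreal (std_normal_density g) * ennreal (exp ((a * t) * g))) \<partial>lborel)"
      unfolding F_def yZ
      by (intro nn_integral_cong)
         (simp add: c_def t_def exp_add mult_ac flip: ennreal_mult')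
    also have "\<dots> = ennreal (exp c) * ennreal (exp ((a * t)\<^sup>2 / 2))"
      by (subst nn_integral_cmult) (simp_all add: std_normal_mgf)
    also have "\<dots> = ennreal (exp (l * energy (u # us) (Z \<omega>) + scalar_prod v (Z \<omega>)))"
      by (simp add: c_def t_def power_mult_distrib a algebra_simps flip: ennreal_mult' exp_add)
    finally show "ennreal (exp (l * energy (u # us) (Z \<omega>) + scalar_prod v (Z \<omega>))) = (\<integral>\<^sup>+g. F \<omega> g \<partial>lborel)" ..
  qed
  \<comment> \<open>Exchanging the integrals lets the induction hypothesis act on the noise for each
    fixed \<open>g\<close>.\<close>
  also have "\<dots> = (\<integral>\<^sup>+g. \<integral>\<^sup>+\<omega>. F \<omega> g \<partial>M \<partial>lborel)"
    by (rule P.Fubini'[symmetric]) simp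
  also have "\<dots> = (\<integral>\<^sup>+g. ennreal (C ^ length us * exp (scalar_prod v v / 2))
      * (ennreal (std_normal_density g) * ennreal (exp (l * g\<^sup>2))) \<partial>lborel)"
  proof (intro nn_integral_cong)
    fix g
    have "(\<integral>\<^sup>+\<omega>. F \<omega> g \<partial>M) = ennreal (std_normal_density g)
        * ennreal (C ^ length us * exp (scalar_prod (y g) (y g) / 2))"
      unfolding F_def C_def Cons.IH[OF o(1) y yu, symmetric] by (rule nn_integral_cmult) simp
    also have "\<dots> = ennreal (C ^ length us * exp (scalar_prod v v / 2))
        * (ennreal (std_normal_density g) * ennreal (exp (l * g\<^sup>2)))"
      using C by (simp add: yy add_divide_distrib exp_add mult_ac flip: ennreal_mult')
    finally show "(\<integral>\<^sup>+\<omega>. F \<omega> g \<partial>M) = \<dots>" .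
  qed
  also have "\<dots> = ennreal (C ^ length us * exp (scalar_prod v v / 2)) * ennreal C"
    using assms by (subst nn_integral_cmult) (simp_all add: std_normal_square_mgf C_def)
  also have "\<dots> = ennreal (C ^ length (u # us) * exp (scalar_prod v v / 2))"
    using C by (simp add: mult_ac flip: ennreal_mult')
  finally show ?case by (simp only: C_def)
qed

section \<open>Chernoff bounds\<close>

text \<open>Markov's inequality for the exponential of the energy. The parameter \<open>l\<close>
  stays free because its two uses differ: 1/4 is enough for the misfit noise, while overfitting
  needs values close to 1/2, where the rate is almost \<open>exp (- t / 2)\<close>.\<close>

lemma prob_energy_ge:
  assumes "orthon n us" "0 < l" "l < 1 / 2"
  shows "prob {\<omega> \<in> space M. energy us (Z \<omega>) \<ge> t} \<le> (1 / sqrt (1 - 2 * l)) ^ length us * exp (- l * t)"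
proof -
  have "emeasure M {\<omega> \<in> space M. energy us (Z \<omega>) \<ge> t}
      \<le> ennreal (exp (- l * t)) * (\<integral>\<^sup>+\<omega>. ennreal (exp (l * energy us (Z \<omega>))) * indicator (space M) \<omega> \<partial>M)"
    using assms by (intro Chernoff_ineq_nn_integral_ge) auto
  also have "(\<integral>\<^sup>+\<omega>. ennreal (exp (l * energy us (Z \<omega>))) * indicator (space M) \<omega> \<partial>M)
      = (\<integral>\<^sup>+\<omega>. ennreal (exp (l * energy us (Z \<omega>) + scalar_prod (0\<^sub>v n) (Z \<omega>))) \<partial>M)"
    by (intro nn_integral_cong) simp
  also have "\<dots> = ennreal ((1 / sqrt (1 - 2 * l)) ^ length us)"
    using assms orthon_carrier[OF assms(1)] by (subst nn_integral_exp_energy) auto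
  also have "ennreal (exp (- l * t)) * \<dots> = ennreal ((1 / sqrt (1 - 2 * l)) ^ length us * exp (- l * t))"
    using assms by (simp add: mult.commute flip: ennreal_mult')
  finally show ?thesis
    using assms by (simp add: emeasure_eq_measure)
qed

text \<open>Chernoff with parameter 1/4. The base is \<open>exp (- 1 / 2) * sqrt 2\<close>, which is
  below 1 because e > 2.\<close>

lemma prob_norm_ge:
  "prob {\<omega> \<in> space M. scalar_prod (Z \<omega>) (Z \<omega>) \<ge> 2 * n} \<le> (sqrt (2 / exp 1)) ^ n"
proof -
  have "emeasure M {\<omega> \<in> space M. scalar_prod (Z \<omega>) (Z \<omega>) \<ge> 2 * n}
      \<le> ennreal (exp (- (1/4) * (2 * n)))
        * (\<integral>\<^sup>+\<omega>. ennreal (exp (1/4 * scalar_prod (Z \<omega>) (Z \<omega>))) * indicator (space M) \<omega> \<partial>M)"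
    by (intro Chernoff_ineq_nn_integral_ge) auto
  also have "(\<integral>\<^sup>+\<omega>. ennreal (exp (1/4 * scalar_prod (Z \<omega>) (Z \<omega>))) * indicator (space M) \<omega> \<partial>M)
      = (\<integral>\<^sup>+\<omega>. ennreal (exp (1/4 * scalar_prod (Z \<omega>) (Z \<omega>))) \<partial>M)"
    by (intro nn_integral_cong) simp
  also have "\<dots> = ennreal (sqrt 2 ^ n)"
    by (subst nn_integral_exp_norm) (simp_all add: real_sqrt_divide)
  also have "ennreal (exp (- (1/4) * (2 * n))) * ennreal (sqrt 2 ^ n) = ennreal (exp (- n / 2) * sqrt 2 ^ n)"
    by (simp flip: ennreal_mult')
  also have "exp (- n / 2) * sqrt 2 ^ n = sqrt (2 / exp 1) ^ n"
  proof -
    have "(exp (- 1 / 2 :: real))\<^sup>2 = exp (- 1)" by (simp add: power2_eq_square flip: exp_add)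
    then have "exp (- 1 / 2 :: real) = sqrt (1 / exp 1)"
      by (intro real_sqrt_unique[symmetric]) (simp_all add: exp_minus inverse_eq_divide)
    moreover have "exp (- real n / 2) = exp (- 1 / 2) ^ n" by (simp flip: exp_of_nat_mult)
    ultimately show ?thesis by (simp add: real_sqrt_divide power_divide)
  qed
  finally show ?thesis by (simp add: emeasure_eq_measure)
qed

text \<open>Chernoff with the negative parameter -h/4. By ln (1 + y) \<ge> y - y^2 at y = h/2, the
  exponent is at most n times h/4 * (1 - h) - (h/2 - h^2/4) / 2, which equals -h^2/8.\<close>

lemma prob_norm_le:
  fixes h :: real
  assumes "0 < h" "h \<le> 1"
  shows "prob {\<omega> \<in> space M. scalar_prod (Z \<omega>) (Z \<omega>) \<le> n * (1 - h)} \<le> exp (- (n * h\<^sup>2 / 8))"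
proof -
  have "emeasure M {\<omega> \<in> space M. scalar_prod (Z \<omega>) (Z \<omega>) \<le> n * (1 - h)}
      \<le> ennreal (exp (h / 4 * (n * (1 - h))))
        * (\<integral>\<^sup>+\<omega>. ennreal (exp (- (h / 4) * scalar_prod (Z \<omega>) (Z \<omega>))) * indicator (space M) \<omega> \<partial>M)"
    using assms by (intro Chernoff_ineq_nn_integral_le) auto
  also have "(\<integral>\<^sup>+\<omega>. ennreal (exp (- (h / 4) * scalar_prod (Z \<omega>) (Z \<omega>))) * indicator (space M) \<omega> \<partial>M)
      = (\<integral>\<^sup>+\<omega>. ennreal (exp (- (h / 4) * scalar_prod (Z \<omega>) (Z \<omega>))) \<partial>M)"
    by (intro nn_integral_cong) simp
  also have "\<dots> = ennreal ((1 / sqrt (1 + h / 2)) ^ n)"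
    using assms by (subst nn_integral_exp_norm) simp_all
  also have "\<dots> \<le> ennreal (exp (- (h / 2 - h\<^sup>2 / 4) / 2) ^ n)"
  proof (intro ennreal_leI power_mono)
    have "exp (h / 2 - h\<^sup>2 / 4) \<le> 1 + h / 2"
      using assms ln_one_plus_pos_lower_bound[of "h / 2"]
      by (subst ln_ge_iff[symmetric]) (simp_all add: power_divide)
    then have "sqrt (exp (h / 2 - h\<^sup>2 / 4)) \<le> sqrt (1 + h / 2)" by simp
    moreover have "sqrt (exp (h / 2 - h\<^sup>2 / 4)) = exp ((h / 2 - h\<^sup>2 / 4) / 2)"
      by (rule real_sqrt_unique) (simp_all add: power2_eq_square flip: exp_add)
    ultimately have "1 / sqrt (1 + h / 2) \<le> 1 / exp ((h / 2 - h\<^sup>2 / 4) / 2)"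
      using assms by (intro divide_left_mono) auto
    also have "\<dots> = exp (- (h / 2 - h\<^sup>2 / 4) / 2)" unfolding minus_divide_left[symmetric] exp_minus by (simp add: inverse_eq_divide)
    finally show "1 / sqrt (1 + h / 2) \<le> exp (- (h / 2 - h\<^sup>2 / 4) / 2)" .
  qed (use assms in auto)
  also have "ennreal (exp (h / 4 * (n * (1 - h)))) * ennreal (exp (- (h / 2 - h\<^sup>2 / 4) / 2) ^ n)
      = ennreal (exp (- (n * h\<^sup>2 / 8)))"
    by (simp flip: ennreal_mult' exp_of_nat_mult exp_add) (simp add: field_simps power2_eq_square)
  finally show ?thesis by (simp add: emeasure_eq_measure mult_left_mono)
qed

end

section \<open>A bound for fixed sample size\<close>

text \<open>The product of \<open>c + 1\<close> over \<open>A\<close>, expanded: a subset records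
  the factors from which \<open>c\<close> is chosen.\<close>

lemma sum_Pow_power_card:
  fixes c :: "'b :: comm_semiring_1"
  assumes "finite A"
  shows "(\<Sum>t\<in>Pow A. c ^ card t) = (c + 1) ^ card A"
  using prod_add[OF assms, of "\<lambda>_. c" "\<lambda>_. 1"] by simp

lemma one_plus_div_power_le_exp:
  fixes c :: real
  assumes "0 \<le> c" "1 \<le> p"
  shows "(c / real p + 1) ^ p \<le> exp c"
proof -
  have "(c / real p + 1) ^ p \<le> exp (c / real p) ^ p"
    using assms exp_ge_add_one_self[of "c / real p"] by (intro power_mono) (auto simp: add.commute)
  also have "\<dots> = exp c" using assms by (simp flip: exp_of_nat_mult)
  finally show ?thesis .
qed

section \<open>Deterministic comparison of criterion values\<close>

lemma overfit_comparison:
  fixes m N P a D v j :: real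
  defines "h \<equiv> N / (32 * P)"
  assumes "0 < m" "0 < v" "0 < N" "N \<le> P" "0 < j" "0 \<le> D"
    and a: "a \<ge> v * m * (1 - 2 * h)"
    and D: "D \<le> v * (2 * j * (P + 3 / 8 * N))"
  shows "m * ln (a + D) < m * ln a + j * (N + 2 * P)"
proof -
  have P: "P > 0" using assms by simp
  have h: "0 < h" "h \<le> 1 / 32" "h * P = N / 32"
    using assms P by (auto simp: h_def divide_simps)
  have vm: "v * m * (1 - 2 * h) > 0" using assms h by simp
  then have a0: "a > 0" using a by simp
  define X where "X = h * N"
  have "X \<le> N / 32" using mult_right_mono[OF h(2), of N] assms by (simp add: X_def)
  \<comment> \<open>The right side is \<open>(1 - 2 * h) * (N + 2 * P)\<close> written out with
    \<open>h * P = N / 32\<close>; the loss \<open>2 * X + N / 8\<close> stays below the available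
    \<open>N / 4\<close>.\<close>
  then have "2 * (P + 3 / 8 * N) < N + 2 * P - 2 * X - 4 * (N / 32)" using \<open>0 < N\<close> by simp
  also have "\<dots> = (1 - 2 * h) * (N + 2 * P)"
    unfolding X_def h(3)[symmetric] by (simp only: algebra_simps)
  finally have key: "2 * (P + 3 / 8 * N) < (1 - 2 * h) * (N + 2 * P)" .
  have "ln (a + D) - ln a = ln (1 + D / a)"
    using a0 \<open>0 \<le> D\<close> ln_div[of "a + D" a] by (simp add: add_divide_distrib)
  also have "\<dots> \<le> D / a" using a0 assms by (intro ln_add_one_self_le_self) auto
  also have "\<dots> \<le> D / (v * m * (1 - 2 * h))"
    using a vm a0 assms by (intro divide_left_mono) auto
  also have "\<dots> \<le> v * (2 * j * (P + 3 / 8 * N)) / (v * m * (1 - 2 * h))"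
    using vm D by (intro divide_right_mono) auto
  also have "\<dots> = j * (2 * (P + 3 / 8 * N)) / (m * (1 - 2 * h))"
    using assms by simp
  also have "\<dots> < j * ((1 - 2 * h) * (N + 2 * P)) / (m * (1 - 2 * h))"
    using key assms h by (intro divide_strict_right_mono mult_strict_left_mono) auto
  also have "\<dots> = j * (N + 2 * P) / m" using assms h by simp
  finally have "m * (ln (a + D) - ln a) < m * (j * (N + 2 * P) / m)"
    using assms by (intro mult_strict_left_mono) auto
  also have "\<dots> = j * (N + 2 * P)" using \<open>0 < m\<close> by simp
  finally show ?thesis by (simp add: right_diff_distrib)
qed

text \<open>Here \<open>a\<close> is RSS(s), \<open>b\<close> is RSS(s0), \<open>D\<close> is
  Delta(s), \<open>z\<close> the squared norm of the standardised noise, \<open>E\<close> an energy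
  of it, and \<open>Q\<close> the penalty of the true model, the most that a misfit can save. Since
  \<open>v * E \<le> D / 16\<close>, the cross term takes at most \<open>D / 2\<close>, and RSS
  still rises by \<open>4 * v * T\<close>.\<close>

lemma misfit_comparison:
  fixes m N P a b D v T Q E z :: real
  assumes "0 < m" "0 < v" "0 < b" "b \<le> v * z" "z \<le> 2 * m"
    and T: "0 < T" "16 * T \<le> m" and E: "0 \<le> E" "E \<le> T" and D: "16 * v * T \<le> D"
    and a: "a \<ge> D - 2 * sqrt D * sqrt (v * E) + v * z - v * E"
    and Q: "Q < T"
  shows "m * ln a > m * ln b + Q"
proof -
  have vE: "v * E \<le> v * T" "0 \<le> v * E" using assms by auto
  have D0: "D > 0" using D T assms by (smt (verit) mult_pos_pos)
  have "sqrt D * sqrt (v * E) \<le> sqrt D * sqrt (D / 16)"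
    using D vE D0 by (intro mult_left_mono real_sqrt_le_mono) auto
  also have "\<dots> = D / 4" using D0 by (simp add: real_sqrt_divide)
  finally have "sqrt D * sqrt (v * E) \<le> D / 4" .
  moreover have "16 * (v * T) \<le> D" using D by (simp only: mult.assoc)
  moreover have "a \<ge> D - 2 * (sqrt D * sqrt (v * E)) + v * z - v * E" using a by (simp only: mult.assoc)
  ultimately have ab: "a \<ge> b + 4 * (v * T)" using vE \<open>b \<le> v * z\<close> D0 by linarith
  have vT: "v * T > 0" using assms by simp
  \<comment> \<open>A lower bound for the relative increase \<open>4 * v * T / b\<close>, because
    \<open>b \<le> 2 * v * m\<close>. It satisfies \<open>m * u / 2 = T\<close>, and
    \<open>u \<le> 1 / 8\<close> ensures that the logarithm keeps at least
    \<open>u / 2\<close>.\<close>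
  define u where "u = 2 * T / m"
  have u: "0 < u" "u \<le> 1 / 8" using assms by (auto simp: u_def field_simps)
  have "u = 4 * (v * T) / (v * (2 * m))" using assms by (simp add: u_def)
  also have "\<dots> \<le> 4 * (v * T) / b"
    using assms vT by (intro divide_left_mono) (auto intro: order_trans[OF \<open>b \<le> v * z\<close>])
  finally have "b * (1 + u) \<le> a" using ab assms by (simp add: field_simps)
  moreover have "0 < b * (1 + u)" using u assms by simp
  ultimately have "ln (b * (1 + u)) \<le> ln a" by (subst ln_le_cancel_iff) (auto intro: less_le_trans)
  then have "ln b + ln (1 + u) \<le> ln a" using u assms by (simp add: ln_mult)
  moreover have "u - u\<^sup>2 \<le> ln (1 + u)" using u by (intro ln_one_plus_pos_lower_bound) auto
  moreover have "u\<^sup>2 \<le> u * (1 / 8)" unfolding power2_eq_square using u by (intro mult_left_mono) auto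
  ultimately have "ln b + u / 2 \<le> ln a" using u by simp
  then have "m * (ln b + u / 2) \<le> m * ln a" using assms by (intro mult_left_mono) auto
  then show ?thesis using assms Q by (simp add: u_def algebra_simps)
qed

lemma energy_smult:
  assumes "set us \<subseteq> carrier_vec n" "w \<in> carrier_vec n"
  shows "energy us (c \<cdot>\<^sub>v w) = c\<^sup>2 * energy us w"
  using assms by (induction us) (auto simp: power_mult_distrib algebra_simps)

section \<open>The union bound over all models\<close>

context std_gaussian
begin

text \<open>Written in a basis of the model, RSS is a quadratic polynomial in the noise. This makes
  the event of correct selection measurable.\<close>

lemma RSS_measurable [measurable]:
  "(\<lambda>\<omega>. RSS n x (mean_vec n p x b + \<sigma> \<cdot>\<^sub>v Z \<omega>) s) \<in> borel_measurable M"
proof -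
  obtain us where us: "onb_of n (design_cols n x s) us"
    using onb_exists[OF design_cols_carrier, of n x s] by auto
  have c: "set us \<subseteq> carrier_vec n" using us orthon_carrier by (auto simp: onb_of_def)
  define m where "m = mean_vec n p x b - proj n us (mean_vec n p x b)"
  have m: "m \<in> carrier_vec n" using c mean_vec_carrier by (simp add: m_def)
  have "RSS n x (mean_vec n p x b + \<sigma> \<cdot>\<^sub>v Z \<omega>) s =
      scalar_prod m m + 2 * (\<sigma> * scalar_prod m (Z \<omega>)) + \<sigma> * (\<sigma> * scalar_prod (Z \<omega>) (Z \<omega>))
        - \<sigma>\<^sup>2 * energy us (Z \<omega>)" for \<omega>
    using RSS_add[OF us mean_vec_carrier, of "\<sigma> \<cdot>\<^sub>v Z \<omega>"] m c
    by (simp add: m_def[symmetric] energy_smult scalar_prod_smult_distrib[of _ n] smult_scalar_prod_distrib[of _ n])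
  then show ?thesis by simp
qed

text \<open>The four error terms belong to these events: the squared noise norm is at most n (1 -
  h), it is at least 2 n, the energy of some \<open>V s\<close> reaches 8 K P, some overfitting
  model gains too much. Outside them the comparison is deterministic. The 128 is 16 * 8, since
  \<open>misfit_comparison\<close> asks for \<open>16 * v * T \<le> D\<close> at
  \<open>T = 8 * (K * P)\<close>.\<close>

lemma mBIC_prob_bound:
  fixes p :: nat and x :: "nat \<Rightarrow> nat \<Rightarrow> real" and b :: "nat \<Rightarrow> real"
    and \<sigma> k P N K h L q :: real
  defines "s0 \<equiv> true_model p b"
  defines "P \<equiv> ln (real p)" and "N \<equiv> ln (real n)" and "K \<equiv> k * card s0"
  defines "h \<equiv> N / (32 * P)" and "L \<equiv> P + 3 / 8 * N"
  defines "q \<equiv> sqrt (2 * exp 1 * L) * real n powr (- 3 / 8)"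
  assumes n: "3 \<le> n" "n \<le> p" and sig: "\<sigma> > 0" and k: "k > 1" and p0: "card s0 \<ge> 1"
    and small: "8 * K * P \<le> h * n"
    and consistent: "\<And>s. s \<subseteq> {1..p} \<Longrightarrow> \<not> s0 \<subseteq> s \<Longrightarrow> real (card s) \<le> K \<Longrightarrow>
      128 * \<sigma>\<^sup>2 * (K * P) \<le> Delta n p x b s"
  defines "mb \<equiv> \<lambda>\<omega>. mBIC n p x (mean_vec n p x b + \<sigma> \<cdot>\<^sub>v Z \<omega>)"
  shows "prob {\<omega> \<in> space M. \<forall>s. s \<subseteq> {1..p} \<and> s \<noteq> s0 \<and> real (card s) \<le> K \<longrightarrow> mb \<omega> s > mb \<omega> s0}
    \<ge> 1 - (exp (- (n * h\<^sup>2 / 8)) + sqrt (2 / exp 1) ^ n + 2 * exp 2 / p + (exp q - 1))"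
proof -
  have fin0: "finite s0" by (simp add: s0_def)
  have s0p: "s0 \<subseteq> {1..p}" by (auto simp: s0_def true_model_def)
  have "ln 3 \<le> N" using n by (simp add: N_def)
  then have N1: "N > 1" using ln3_gt_1 by simp
  have NP: "N \<le> P" using n by (simp add: N_def P_def)
  then have P1: "P > 1" using N1 by simp
  have h: "0 < h" "h \<le> 1 / 32" using N1 NP by (auto simp: h_def divide_simps)
  have "1 * 1 \<le> K" unfolding K_def using k p0 by (intro mult_mono) auto
  then have K1: "K \<ge> 1" by simp
  have "1 * real (card s0) \<le> K" unfolding K_def using k by (intro mult_right_mono) auto
  then have s0K: "real (card s0) \<le> K" by simp
  have L1: "L > 1" using N1 P1 by (simp add: L_def)
  \<comment> \<open>Chernoff with parameter 1/4 gives \<open>exp (- T / 4)\<close>, two factors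
    \<open>exp (- (K * P))\<close>. One is at most \<open>(1 / p) ^ card s\<close> and feeds the
    binomial weights, the other is at most 1 / p because \<open>K \<ge> 1\<close>.\<close>
  define T where "T = 8 * (K * P)"
  have T0: "T > 0" using K1 P1 by (simp add: T_def)
  have Tm: "T \<le> h * n" using small by (simp add: T_def mult.assoc)
  have "h * n \<le> 1 / 32 * real n" using h by (intro mult_right_mono) auto
  with Tm have Tn: "16 * T \<le> n" by simp

  define S where "S = {s. s \<subseteq> {1..p} \<and> real (card s) \<le> K}"
  define S' where "S' = {s. s0 \<subset> s \<and> s \<subseteq> {1..p} \<and> real (card s) \<le> K}"
  have finS: "finite S" "finite S'"
    by (rule finite_subset[of _ "Pow {1..p}"]; auto simp: S_def S'_def)+
  have fins: "finite s" if "s \<subseteq> {1..p}" for s using that finite_subset by blast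

  have "\<exists>vs. orthon n vs \<and> length vs \<le> card s + 2 \<and> (\<forall>e\<in>carrier_vec n. RSS n x (mean_vec n p x b + e) s \<ge>
       Delta n p x b s - 2 * sqrt (Delta n p x b s) * sqrt (energy vs e) + scalar_prod e e - energy vs e)" for s
    by (rule RSS_lower_bound[where n = n and s = s and x = x and p = p and b = b]) blast
  then obtain V where V: "\<And>s. orthon n (V s)" "\<And>s. length (V s) \<le> card s + 2"
    "\<And>s e. e \<in> carrier_vec n \<Longrightarrow> RSS n x (mean_vec n p x b + e) s \<ge>
       Delta n p x b s - 2 * sqrt (Delta n p x b s) * sqrt (energy (V s) e) + scalar_prod e e - energy (V s) e"
    by metis
  have "\<forall>s\<in>S'. \<exists>vs. orthon n vs \<and> length vs \<le> card (s - s0) \<and> (\<forall>e\<in>carrier_vec n.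
      RSS n x (mean_vec n p x b + e) s0 - RSS n x (mean_vec n p x b + e) s = energy vs e) \<and> Delta n p x b s = 0"
  proof
    fix s assume "s \<in> S'"
    then have s: "true_model p b \<subseteq> s" "finite s" using fins by (auto simp: S'_def s0_def)
    show "\<exists>vs. orthon n vs \<and> length vs \<le> card (s - s0) \<and> (\<forall>e\<in>carrier_vec n.
      RSS n x (mean_vec n p x b + e) s0 - RSS n x (mean_vec n p x b + e) s = energy vs e) \<and> Delta n p x b s = 0"
      by (rule RSS_overfit[OF s, where n = n and x = x]) (unfold s0_def, blast)
  qed
  then obtain W where W: "\<And>s. s \<in> S' \<Longrightarrow> orthon n (W s)" "\<And>s. s \<in> S' \<Longrightarrow> length (W s) \<le> card (s - s0)"
    "\<And>s e. s \<in> S' \<Longrightarrow> e \<in> carrier_vec n \<Longrightarrow>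
      RSS n x (mean_vec n p x b + e) s0 - RSS n x (mean_vec n p x b + e) s = energy (W s) e"
    "\<And>s. s \<in> S' \<Longrightarrow> Delta n p x b s = 0"
    by metis

  define B1 where "B1 = {\<omega> \<in> space M. scalar_prod (Z \<omega>) (Z \<omega>) \<le> n * (1 - h)}"
  define B2 where "B2 = {\<omega> \<in> space M. scalar_prod (Z \<omega>) (Z \<omega>) \<ge> 2 * n}"
  define B3 where "B3 s = {\<omega> \<in> space M. energy (V s) (Z \<omega>) \<ge> T}" for s
  define B4 where "B4 s = {\<omega> \<in> space M. energy (W s) (Z \<omega>) \<ge> 2 * real (card (s - s0)) * L}" for s
  have ev: "B1 \<in> events" "B2 \<in> events" "B3 s \<in> events" "B4 s \<in> events" for s
    by (auto simp: B1_def B2_def B3_def B4_def)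
  have evU: "(\<Union>s\<in>S. B3 s) \<in> events" "(\<Union>s\<in>S'. B4 s) \<in> events"
    using ev finS by (auto intro!: sets.finite_UN)
  define G where "G = {\<omega> \<in> space M. \<forall>s\<in>S - {s0}. mb \<omega> s > mb \<omega> s0}"
  have G: "G \<in> events"
    unfolding G_def mb_def mBIC_def
    by (intro sets.sets_Collect_finite_All) (use finS in auto)

  have "prob B1 \<le> exp (- (n * h\<^sup>2 / 8))"
    unfolding B1_def using h by (intro prob_norm_le) auto
  moreover have "prob B2 \<le> sqrt (2 / exp 1) ^ n"
    unfolding B2_def by (rule prob_norm_ge)
  moreover have "prob (\<Union>s\<in>S. B3 s) \<le> 2 * exp 2 / p"
  proof -
    have "prob (B3 s) \<le> 2 * exp (- (K * P)) * (2 / p) ^ card s" if s: "s \<in> S" for s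
    proof -
      have "prob (B3 s) \<le> (1 / sqrt (1 - 2 * (1 / 4))) ^ length (V s) * exp (- (1 / 4) * T)"
        unfolding B3_def by (rule prob_energy_ge[OF V(1)]) auto
      also have "1 / sqrt (1 - 2 * (1 / 4)) = sqrt 2" by (simp add: real_sqrt_divide)
      also have "sqrt 2 ^ length (V s) \<le> sqrt 2 ^ (card s + 2)"
        using V(2) by (intro power_increasing) auto
      also have "\<dots> = 2 * sqrt 2 ^ card s" by simp
      also have "\<dots> \<le> 2 * 2 ^ card s"
        using sqrt2_less_2 by (intro mult_left_mono power_mono) auto
      also have "exp (- (1 / 4) * T) = exp (- (K * P)) * exp (- (K * P))"
        by (simp add: T_def flip: exp_add)
      also have "\<dots> \<le> exp (- (K * P)) * exp (- (real (card s) * P))"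
        using s P1 by (intro mult_left_mono) (auto simp: S_def)
      also have "exp (- (real (card s) * P)) = (1 / p) ^ card s"
        using n by (simp add: P_def exp_of_nat_mult exp_minus inverse_eq_divide power_divide)
      finally show ?thesis by (simp add: power_divide mult_right_mono mult_ac)
    qed
    then have "(\<Sum>s\<in>S. prob (B3 s)) \<le> (\<Sum>s\<in>S. 2 * exp (- (K * P)) * (2 / p) ^ card s)"
      by (rule sum_mono)
    also have "\<dots> \<le> (\<Sum>s\<in>Pow {1..p}. 2 * exp (- (K * P)) * (2 / p) ^ card s)"
      by (rule sum_mono2) (auto simp: S_def)
    also have "\<dots> = 2 * exp (- (K * P)) * (2 / p + 1) ^ p"
      by (simp add: sum_distrib_left[symmetric] sum_Pow_power_card)
    also have "\<dots> \<le> 2 * exp (- (K * P)) * exp 2"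
      using n one_plus_div_power_le_exp[of 2 p] by (intro mult_left_mono) auto
    also have "\<dots> \<le> 2 * exp (- (1 * P)) * exp 2"
      using K1 P1 by (intro mult_left_mono mult_right_mono) auto
    also have "\<dots> = 2 * exp 2 / p" using n by (simp add: P_def exp_minus inverse_eq_divide)
    finally show ?thesis
      by (rule order_trans[OF finite_measure_subadditive_finite[OF finS(1)], rotated]) (auto simp: ev)
  qed
  moreover have "prob (\<Union>s\<in>S'. B4 s) \<le> exp q - 1"
  proof -
    define l where "l = 1 / 2 - 1 / (4 * L)"
    have l: "0 < l" "l < 1 / 2" "1 - 2 * l = 1 / (2 * L)" using L1 by (auto simp: l_def field_simps)
    have q0: "q \<ge> 0" using L1 by (simp add: q_def)
    have b4: "prob (B4 s) \<le> (q / p) ^ card (s - s0)" if s: "s \<in> S'" for s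
    proof -
      let ?j = "card (s - s0)"
      have "prob (B4 s) \<le> (1 / sqrt (1 - 2 * l)) ^ length (W s) * exp (- l * (2 * real ?j * L))"
        unfolding B4_def by (rule prob_energy_ge[OF W(1)[OF s] l(1,2)])
      also have "1 / sqrt (1 - 2 * l) = sqrt (2 * L)" by (simp add: l(3) real_sqrt_divide)
      also have "sqrt (2 * L) ^ length (W s) \<le> sqrt (2 * L) ^ ?j"
        using W(2)[OF s] L1 by (intro power_increasing) auto
      also have "exp (- l * (2 * real ?j * L)) = exp (1 / 2 - L) ^ ?j"
        using L1 by (simp add: l_def field_simps flip: exp_of_nat_mult)
      also have "exp (1 / 2 - L) = sqrt (exp 1) * real n powr (- 3 / 8) / p"
      proof -
        have "exp (1 / 2 - L) = exp (1 / 2) * exp (- (3 / 8) * N) / exp P"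
          by (simp add: L_def flip: exp_add exp_diff)
        moreover have "exp (1 / 2 :: real) = sqrt (exp 1)"
          by (rule real_sqrt_unique[symmetric]) (simp_all add: power2_eq_square flip: exp_add)
        moreover have "exp (- (3 / 8) * N) = real n powr (- 3 / 8)"
          using n by (simp add: N_def powr_def)
        ultimately show ?thesis using n by (simp add: P_def)
      qed
      also have "sqrt (2 * L) ^ ?j * (sqrt (exp 1) * real n powr (- 3 / 8) / p) ^ ?j = (q / p) ^ ?j"
        by (simp add: q_def real_sqrt_mult power_mult_distrib power_divide mult_ac)
      finally show ?thesis by (simp add: mult_right_mono)
    qed
    have "(\<Sum>s\<in>S'. prob (B4 s)) \<le> (\<Sum>s\<in>S'. (q / p) ^ card (s - s0))"
      using b4 by (rule sum_mono)
    also have "\<dots> = (\<Sum>t\<in>(\<lambda>s. s - s0) ` S'. (q / p) ^ card t)"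
      by (subst sum.reindex) (auto simp: inj_on_def S'_def)
    also have "\<dots> \<le> (\<Sum>t\<in>Pow {1..p} - {{}}. (q / p) ^ card t)"
      using q0 by (intro sum_mono2) (auto simp: S'_def)
    also have "\<dots> = (q / p + 1) ^ p - 1"
      by (subst sum_diff) (auto simp: sum_Pow_power_card)
    also have "\<dots> \<le> exp q - 1"
      using one_plus_div_power_le_exp[OF q0, of p] n by simp
    finally show ?thesis
      by (rule order_trans[OF finite_measure_subadditive_finite[OF finS(2)], rotated]) (auto simp: ev)
  qed
  moreover have "prob (space M - G) \<le> prob B1 + prob B2 + prob (\<Union>s\<in>S. B3 s) + prob (\<Union>s\<in>S'. B4 s)"
  proof -
    have "space M - G \<subseteq> B1 \<union> B2 \<union> (\<Union>s\<in>S. B3 s) \<union> (\<Union>s\<in>S'. B4 s)"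
    proof
      fix \<omega> assume om: "\<omega> \<in> space M - G"
      show "\<omega> \<in> B1 \<union> B2 \<union> (\<Union>s\<in>S. B3 s) \<union> (\<Union>s\<in>S'. B4 s)"
      proof (rule ccontr)
        assume good: "\<omega> \<notin> B1 \<union> B2 \<union> (\<Union>s\<in>S. B3 s) \<union> (\<Union>s\<in>S'. B4 s)"
        define z where "z = scalar_prod (Z \<omega>) (Z \<omega>)"
        define y where "y = mean_vec n p x b + \<sigma> \<cdot>\<^sub>v Z \<omega>"
        define v where "v = \<sigma>\<^sup>2"
        have v: "v > 0" using sig by (simp add: v_def)
        have z: "z > n * (1 - h)" "z < 2 * n"
          using good om by (auto simp: B1_def B2_def z_def)
        have g3: "energy (V s) (Z \<omega>) < T" if "s \<in> S" for s
          using good om that by (auto simp: B3_def)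
        have g4: "energy (W s) (Z \<omega>) < 2 * real (card (s - s0)) * L" if "s \<in> S'" for s
          using good om that by (force simp: B4_def)
        have zz: "scalar_prod (\<sigma> \<cdot>\<^sub>v Z \<omega>) (\<sigma> \<cdot>\<^sub>v Z \<omega>) = v * z"
          by (simp add: z_def v_def power2_eq_square)
        have en: "energy (V s) (\<sigma> \<cdot>\<^sub>v Z \<omega>) = v * energy (V s) (Z \<omega>)" for s
          using orthon_carrier[OF V(1)] by (simp add: energy_smult[of _ n] v_def)
        have lower: "RSS n x y s \<ge> Delta n p x b s - 2 * sqrt (Delta n p x b s) * sqrt (v * energy (V s) (Z \<omega>))
            + v * z - v * energy (V s) (Z \<omega>)" for s
          using V(3)[of "\<sigma> \<cdot>\<^sub>v Z \<omega>" s] by (simp add: en zz y_def)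
        \<comment> \<open>One \<open>h\<close> is lost to the norm of the noise and one to its
          energy, which is below \<open>T \<le> h * n\<close>.\<close>
        have fit: "RSS n x y s \<ge> v * n * (1 - 2 * h)" if "s \<in> S" "Delta n p x b s = 0" for s
        proof -
          have "v * n * (1 - 2 * h) = v * (n * (1 - h) - h * n)" by (simp add: algebra_simps)
          also have "\<dots> \<le> v * (z - energy (V s) (Z \<omega>))"
            using z g3[OF that(1)] Tm v by (intro mult_left_mono) auto
          also have "\<dots> \<le> RSS n x y s" using lower[of s] that(2) by (simp add: algebra_simps)
          finally show ?thesis .
        qed
        have vn: "v * n * (1 - 2 * h) > 0" using v n h by simp
        have s0S: "s0 \<in> S" using s0p s0K by (simp add: S_def)
        have "Delta n p x b s0 = 0"
          unfolding s0_def by (rule RSS_overfit[where p = p and b = b and n = n and x = x and s = s0]) (auto simp: s0_def)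
        \<comment> \<open>Positivity rules out the default value \<open>ln 0 = 0\<close> at the true
          model.\<close>
        then have r0: "RSS n x y s0 > 0" using fit[OF s0S] vn by linarith
        have r0': "RSS n x y s0 \<le> v * z"
          using RSS_true_le[where e = "\<sigma> \<cdot>\<^sub>v Z \<omega>" and n = n and x = x and p = p and b = b] by (simp add: zz y_def s0_def)
        have "mb \<omega> s > mb \<omega> s0" if s: "s \<in> S - {s0}" for s
        proof (cases "s0 \<subseteq> s")
          case True
          then have s': "s \<in> S'" using s by (auto simp: S_def S'_def)
          have "finite s" using s fins by (auto simp: S_def)
          moreover from this have "card s = card s0 + card (s - s0)"
            using True fin0 card_mono[of s s0] by (simp add: card_Diff_subset)
          moreover have "s - s0 \<noteq> {}" using True s by auto
          ultimately have "card (s - s0) > 0" "card s = card s0 + card (s - s0)"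
            by (auto simp: card_gt_0_iff)
          moreover have d: "RSS n x y s0 - RSS n x y s = v * energy (W s) (Z \<omega>)"
            using W(3)[OF s', of "\<sigma> \<cdot>\<^sub>v Z \<omega>"] orthon_carrier[OF W(1)[OF s']]
            by (simp add: energy_smult[of _ n] v_def y_def)
          have "n * ln (RSS n x y s + v * energy (W s) (Z \<omega>))
              < n * ln (RSS n x y s) + card (s - s0) * (N + 2 * P)"
          proof (rule overfit_comparison[where v = v])
            show "RSS n x y s \<ge> v * n * (1 - 2 * (N / (32 * P)))"
              using fit W(4)[OF s'] s by (simp add: h_def)
            show "v * energy (W s) (Z \<omega>) \<le> v * (2 * real (card (s - s0)) * (P + 3 / 8 * N))"
              using g4[OF s'] v by (intro mult_left_mono) (auto simp: L_def)
          qed (use v n N1 NP energy_nonneg \<open>card (s - s0) > 0\<close> in auto)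
          moreover have "RSS n x y s + v * energy (W s) (Z \<omega>) = RSS n x y s0" using d by simp
          ultimately show ?thesis
            by (simp add: mb_def mBIC_def y_def[symmetric] N_def[symmetric] P_def[symmetric] algebra_simps)
        next
          case False
          have sS: "s \<in> S" using s by simp
          have "n * ln (RSS n x y s) > n * ln (RSS n x y s0) + card s0 * (N + 2 * P)"
          proof (rule misfit_comparison[where v = v and z = z and T = T and E = "energy (V s) (Z \<omega>)"
                and D = "Delta n p x b s"])
            show "16 * v * T \<le> Delta n p x b s"
              using consistent[of s] False sS by (simp add: S_def T_def v_def)
            \<comment> \<open>A misfit saves at most the whole penalty of \<open>s0\<close>. As
              \<open>N \<le> P\<close>, this is at most \<open>3 * K * P\<close>, against
              \<open>T = 8 * K * P\<close>.\<close>
            have "card s0 * (N + 2 * P) \<le> K * (3 * P)"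
              using s0K NP N1 P1 K1 by (intro mult_mono) auto
            moreover have "K * P > 0" using K1 P1 by simp
            ultimately show "card s0 * (N + 2 * P) < T" by (simp add: T_def)
          qed (use lower n v r0 r0' z T0 Tn g3[OF sS] energy_nonneg in auto)
          moreover have "0 \<le> card s * (N + 2 * P)" using N1 P1 by simp
          ultimately show ?thesis
            by (simp add: mb_def mBIC_def y_def[symmetric] N_def[symmetric] P_def[symmetric] algebra_simps)
        qed
        then show False using om by (auto simp: G_def)
      qed
    qed
    then have "prob (space M - G) \<le> prob (B1 \<union> B2 \<union> (\<Union>s\<in>S. B3 s) \<union> (\<Union>s\<in>S'. B4 s))"
      using ev evU by (intro finite_measure_mono sets.Un) auto
    also have "\<dots> \<le> prob (B1 \<union> B2 \<union> (\<Union>s\<in>S. B3 s)) + prob (\<Union>s\<in>S'. B4 s)"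
      using ev evU by (intro measure_Un_le) auto
    also have "prob (B1 \<union> B2 \<union> (\<Union>s\<in>S. B3 s)) \<le> prob (B1 \<union> B2) + prob (\<Union>s\<in>S. B3 s)"
      using ev evU by (intro measure_Un_le) auto
    also have "prob (B1 \<union> B2) \<le> prob B1 + prob B2"
      using ev by (intro measure_Un_le) auto
    finally show ?thesis by simp
  qed
  moreover have "{\<omega> \<in> space M. \<forall>s. s \<subseteq> {1..p} \<and> s \<noteq> s0 \<and> real (card s) \<le> K \<longrightarrow> mb \<omega> s > mb \<omega> s0} = G"
    by (auto simp: G_def S_def)
  ultimately show ?thesis using prob_compl[OF G] by simp
qed

end

section \<open>Consistency\<close>

lemma std_gaussian_scaled:
  assumes "prob_space M" "prob_space.indep_vars M (\<lambda>_. borel) e {1..n}" "0 < \<sigma>"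
    and "\<And>i. i \<in> {1..n} \<Longrightarrow> distributed M lborel (e i) (normal_density 0 \<sigma>)"
  shows "std_gaussian M (\<lambda>i \<omega>. e i \<omega> / \<sigma>) n"
proof -
  interpret prob_space M by fact
  show ?thesis
  proof
    show "indep_vars (\<lambda>_. borel) (\<lambda>i \<omega>. e i \<omega> / \<sigma>) {1..n}"
      by (rule indep_vars_compose2[OF assms(2)]) simp
    show "distributed M lborel (\<lambda>\<omega>. e i \<omega> / \<sigma>) std_normal_density" if "i \<in> {1..n}" for i
      using assms(4)[OF that] normal_standard_normal_convert[OF assms(3), of "e i" 0] by simp
  qed
qed

text \<open>A triangular array: each sample size has its own space \<open>M n\<close> and errors
  \<open>\<epsilon> n\<close>. The probability is squeezed between \<open>1 - err n\<close> and
  1.\<close>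

theorem theorem1:
  fixes M :: "nat \<Rightarrow> 'a measure"
    and \<epsilon> :: "nat \<Rightarrow> nat \<Rightarrow> 'a \<Rightarrow> real"
    and p p0 :: "nat \<Rightarrow> nat"
    and x :: "nat \<Rightarrow> nat \<Rightarrow> nat \<Rightarrow> real"
    and \<beta> :: "nat \<Rightarrow> nat \<Rightarrow> real"
    and s0 :: "nat \<Rightarrow> nat set"
    and \<sigma> k \<alpha> :: real
    and K :: "nat \<Rightarrow> real"
  defines "s0 \<equiv> \<lambda>n. true_model (p n) (\<beta> n)"
    and "p0 \<equiv> \<lambda>n. card (s0 n)"
    and "K \<equiv> \<lambda>n. k * real (p0 n)"
  assumes "\<And>n. n \<ge> 1 \<Longrightarrow> prob_space (M n)"
    and "\<And>n. n \<ge> 1 \<Longrightarrow> prob_space.indep_vars (M n) (\<lambda>_. borel) (\<epsilon> n) {1..n}"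
    and "\<And>n i. n \<ge> 1 \<Longrightarrow> i \<in> {1..n} \<Longrightarrow>
           distributed (M n) lborel (\<epsilon> n i) (normal_density 0 \<sigma>)"
    and "\<sigma> > 0"
    and "\<And>n. n \<ge> 1 \<Longrightarrow> p n \<ge> n"
    and "\<And>n. n \<ge> 1 \<Longrightarrow> p0 n \<ge> 1"
    and "k > 1"
    and "filterlim
           (\<lambda>n. Min {Delta n (p n) (x n) (\<beta> n) s / (real (p0 n) * ln (real (p n))) | s.
                      s \<subseteq> {1..p n} \<and> \<not> s0 n \<subseteq> s \<and> real (card s) \<le> K n})
           at_top sequentially"
    and "1 / 2 \<le> \<alpha>" and "\<alpha> < 1"
    and "(\<lambda>n. real (p0 n) * ln (real (p n))) \<in> O(\<lambda>n. real n powr \<alpha>)"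
    and "(\<lambda>n. ln (real (p n))) \<in> o(\<lambda>n. real n powr (1 - \<alpha>) * ln (real n))"
  shows "(\<lambda>n. measure (M n)
           {\<omega> \<in> space (M n). \<forall>s. s \<subseteq> {1..p n} \<and> s \<noteq> s0 n \<and> real (card s) \<le> K n \<longrightarrow>
              mBIC n (p n) (x n) (response n (p n) (x n) (\<beta> n) (\<lambda>i. \<epsilon> n i \<omega>)) s
                > mBIC n (p n) (x n) (response n (p n) (x n) (\<beta> n) (\<lambda>i. \<epsilon> n i \<omega>)) (s0 n)})
         \<longlonglongrightarrow> 1"
proof -
  define P where "P n = ln (real (p n))" for n
  define N where "N n = ln (real n)" for n
  define h where "h n = N n / (32 * P n)" for n
  define L where "L n = P n + 3 / 8 * N n" for n
  define q where "q n = sqrt (2 * exp 1 * L n) * real n powr (- 3 / 8)" for n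
  define err where "err n = exp (- (n * (h n)\<^sup>2 / 8)) + sqrt (2 / exp 1) ^ n + 2 * exp 2 / p n + (exp (q n) - 1)" for n
  define good where "good n = measure (M n)
           {\<omega> \<in> space (M n). \<forall>s. s \<subseteq> {1..p n} \<and> s \<noteq> s0 n \<and> real (card s) \<le> K n \<longrightarrow>
              mBIC n (p n) (x n) (response n (p n) (x n) (\<beta> n) (\<lambda>i. \<epsilon> n i \<omega>)) s
                > mBIC n (p n) (x n) (response n (p n) (x n) (\<beta> n) (\<lambda>i. \<epsilon> n i \<omega>)) (s0 n)}" for n
  have ev3: "eventually (\<lambda>n. 3 \<le> n) sequentially" by (rule eventually_ge_at_top)
  have basic: "N n > 1" "N n \<le> P n" "real (p n) \<ge> real n" if "3 \<le> n" for n
  proof -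
    show "real (p n) \<ge> real n" using assms(8)[of n] that by simp
    then show "N n \<le> P n" using that by (simp add: N_def P_def)
    have "ln 3 \<le> N n" using that by (simp add: N_def)
    then show "N n > 1" using ln3_gt_1 by simp
  qed
  \<comment> \<open>The constant of the little-o bound stays free; it is taken as
    \<open>1 / (256 * k * C)\<close>, as \<open>1 / (32 * (1 + \<bar>B\<bar>))\<close> and as
    1.\<close>
  have P_small: "eventually (\<lambda>n. P n \<le> c * (real n powr (1 - \<alpha>) * N n)) sequentially" if "c > 0" for c
    using landau_o.smallD[OF assms(15) that] ev3
  proof eventually_elim
    case (elim n)
    then show ?case using basic[of n] by (simp add: P_def N_def)
  qed
  obtain C where C: "C > 0" "eventually (\<lambda>n. real (p0 n) * P n \<le> C * real n powr \<alpha>) sequentially"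
  proof -
    obtain C where "C > 0" "eventually (\<lambda>n. norm (real (p0 n) * P n) \<le> C * norm (real n powr \<alpha>)) sequentially"
      using assms(14) unfolding P_def by (elim landau_o.bigE)
    then show ?thesis by (intro that[of C]) (auto elim: eventually_mono)
  qed
  \<comment> \<open>Multiplied out, \<open>8 * K * P \<le> h * n\<close> reads
    \<open>256 * k * p0 * P^2 \<le> n * N\<close>. The factor \<open>p0 * P\<close> is at most
    \<open>C * n powr \<alpha>\<close>, and this constant in the bound for the other
    \<open>P\<close> brings the product to \<open>n * N\<close>.\<close>
  have "1 / (256 * k * C) > 0" using \<open>k > 1\<close> C(1) by simp
  note P_small_C = P_small[OF this]
  have small: "eventually (\<lambda>n. 8 * K n * P n \<le> h n * n) sequentially"
    using P_small_C C(2) ev3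
  proof eventually_elim
    case (elim n)
    note b = basic[OF elim(3)]
    have kC: "256 * k * C > 0" using \<open>k > 1\<close> C(1) by simp
    have "256 * k * ((real (p0 n) * P n) * P n)
        \<le> 256 * k * ((C * real n powr \<alpha>) * (1 / (256 * k * C) * (real n powr (1 - \<alpha>) * N n)))"
      using b \<open>k > 1\<close> C(1) by (intro mult_left_mono mult_mono[OF elim(2) elim(1)]) auto
    also have "\<dots> = (real n powr \<alpha> * real n powr (1 - \<alpha>)) * N n"
      using \<open>k > 1\<close> C(1) by simp
    also have "real n powr \<alpha> * real n powr (1 - \<alpha>) = n"
      using elim by (simp flip: powr_add)
    finally have "256 * k * (real (p0 n) * P n * P n) \<le> n * N n" .
    then show ?case using b by (simp add: h_def K_def field_simps)
  qed
  \<comment> \<open>\<open>K n * P n\<close> is \<open>k\<close> times the denominator of the ratio,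
    so the minimum only has to exceed \<open>128 * \<sigma>^2 * k\<close>.\<close>
  have cons: "eventually (\<lambda>n. \<forall>s. s \<subseteq> {1..p n} \<longrightarrow> \<not> s0 n \<subseteq> s \<longrightarrow> real (card s) \<le> K n \<longrightarrow>
      128 * \<sigma>\<^sup>2 * (K n * P n) \<le> Delta n (p n) (x n) (\<beta> n) s) sequentially"
    using filterlim_at_top[THEN iffD1, OF assms(11), rule_format, of "128 * \<sigma>\<^sup>2 * k"] ev3
  proof eventually_elim
    case (elim n)
    show ?case
    proof (intro allI impI)
      fix s assume s: "s \<subseteq> {1..p n}" "\<not> s0 n \<subseteq> s" "real (card s) \<le> K n"
      let ?F = "\<lambda>s. Delta n (p n) (x n) (\<beta> n) s / (real (p0 n) * ln (real (p n)))"
      let ?S = "{s. s \<subseteq> {1..p n} \<and> \<not> s0 n \<subseteq> s \<and> real (card s) \<le> K n}"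
      have "finite ?S" by (rule finite_subset[of _ "Pow {1..p n}"]) auto
      then have fin: "finite (?F ` ?S)" by simp
      have "{?F s | s. s \<subseteq> {1..p n} \<and> \<not> s0 n \<subseteq> s \<and> real (card s) \<le> K n} = ?F ` ?S" by auto
      with elim(1) have "128 * \<sigma>\<^sup>2 * k \<le> Min (?F ` ?S)" by (simp only:)
      also have "\<dots> \<le> ?F s" using s by (intro Min_le[OF fin]) blast
      finally have "128 * \<sigma>\<^sup>2 * k \<le> ?F s" .
      moreover have "real (p0 n) * P n > 0" using assms(9)[of n] basic[of n] elim by simp
      ultimately show "128 * \<sigma>\<^sup>2 * (K n * P n) \<le> Delta n (p n) (x n) (\<beta> n) s"
        by (simp add: P_def[symmetric] K_def pos_le_divide_eq mult_ac)
    qed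
  qed
  have lower: "eventually (\<lambda>n. 1 - err n \<le> good n) sequentially"
    using small cons ev3
  proof eventually_elim
    case (elim n)
    then have n: "n \<ge> 1" by simp
    interpret G: std_gaussian "M n" "\<lambda>i \<omega>. \<epsilon> n i \<omega> / \<sigma>" n
      using assms(4-7) n by (intro std_gaussian_scaled) auto
    have "\<sigma> \<cdot>\<^sub>v G.Z \<omega> = Matrix.vec n (\<lambda>i. \<epsilon> n (Suc i) \<omega>)" for \<omega>
      using \<open>\<sigma> > 0\<close> by (intro eq_vecI) (auto simp: G.Z_def)
    then have resp: "response n (p n) (x n) (\<beta> n) (\<lambda>i. \<epsilon> n i \<omega>) = mean_vec n (p n) (x n) (\<beta> n) + \<sigma> \<cdot>\<^sub>v G.Z \<omega>" for \<omega>
      by (simp add: response_eq)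
    show ?case
      unfolding good_def err_def resp K_def p0_def q_def L_def h_def P_def N_def s0_def
    proof (rule G.mBIC_prob_bound)
      show "8 * (k * real (card (true_model (p n) (\<beta> n)))) * ln (real (p n)) \<le> ln (real n) / (32 * ln (real (p n))) * real n"
        using elim(1) by (simp add: K_def p0_def s0_def h_def P_def N_def)
      show "128 * \<sigma>\<^sup>2 * (k * real (card (true_model (p n) (\<beta> n))) * ln (real (p n))) \<le> Delta n (p n) (x n) (\<beta> n) s"
        if "s \<subseteq> {1..p n}" "\<not> true_model (p n) (\<beta> n) \<subseteq> s" "real (card s) \<le> k * real (card (true_model (p n) (\<beta> n)))" for s
        using elim(2) that by (simp add: K_def p0_def s0_def P_def)
      show "1 \<le> card (true_model (p n) (\<beta> n))" using assms(9)[OF n] by (simp add: p0_def s0_def)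
    qed (use assms(7,8,10) n elim in auto)
  qed
  have upper: "eventually (\<lambda>n. good n \<le> 1) sequentially"
    using ev3
  proof eventually_elim
    case (elim n)
    then interpret prob_space "M n" using assms(4) by simp
    show ?case by (simp add: good_def)
  qed
  have "filterlim (\<lambda>n. n * (h n)\<^sup>2) at_top sequentially"
    unfolding filterlim_at_top
  proof
    fix B :: real
    \<comment> \<open>With \<open>r = n powr (1 - \<alpha>)\<close> this constant gives
      \<open>r * h n \<ge> 1 + \<bar>B\<bar>\<close>. Squaring, together with
      \<open>r^2 \<le> n\<close>, yields
      \<open>n * (h n)^2 \<ge> (1 + \<bar>B\<bar>)^2 \<ge> B\<close>.\<close>
    define c where "c = 1 / (32 * (1 + \<bar>B\<bar>))"
    have c: "c > 0" by (simp add: c_def add_pos_nonneg)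
    show "eventually (\<lambda>n. B \<le> n * (h n)\<^sup>2) sequentially"
      using P_small[OF c] ev3
    proof eventually_elim
      case (elim n)
      note b = basic[OF elim(2)]
      define r where "r = real n powr (1 - \<alpha>)"
      have r: "r > 0" using elim by (simp add: r_def)
      \<comment> \<open>Here \<alpha> \<ge> 1/2 enters, as 2 (1 - \<alpha>) \<le> 1.\<close>
      have "r\<^sup>2 \<le> real n"
      proof -
        have "r\<^sup>2 = real n powr (2 * (1 - \<alpha>))"
          using elim by (simp add: r_def power2_eq_square flip: powr_add)
        also have "\<dots> \<le> real n powr 1" using elim \<open>1 / 2 \<le> \<alpha>\<close> by (intro powr_mono) auto
        finally show ?thesis using elim by simp
      qed
      have "1 + \<bar>B\<bar> \<le> r * h n"
      proof -
        have "(1 + \<bar>B\<bar>) * (32 * P n) \<le> (1 + \<bar>B\<bar>) * (32 * (c * (r * N n)))"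
          using elim by (intro mult_left_mono) (auto simp: r_def)
        also have "\<dots> = r * N n"
        proof -
          have "1 + \<bar>B\<bar> \<noteq> 0" by linarith
          then show ?thesis by (simp add: c_def divide_simps)
        qed
        finally show ?thesis using b by (simp add: h_def pos_le_divide_eq)
      qed
      then have "(1 + \<bar>B\<bar>)\<^sup>2 \<le> (r * h n)\<^sup>2" by (intro power_mono) auto
      moreover have "B \<le> (1 + \<bar>B\<bar>)\<^sup>2" by (simp add: power2_sum) (smt (verit) zero_le_power2)
      moreover have "(r * h n)\<^sup>2 \<le> n * (h n)\<^sup>2"
        unfolding power_mult_distrib using \<open>r\<^sup>2 \<le> real n\<close> by (intro mult_right_mono) auto
      ultimately show ?case by linarith
    qed
  qed
  moreover have "((\<lambda>t::real. exp (- (t / 8))) \<longlongrightarrow> 0) at_top" by real_asymp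
  ultimately have e1: "(\<lambda>n. exp (- (n * (h n)\<^sup>2 / 8))) \<longlonglongrightarrow> 0"
    by (rule filterlim_compose[rotated])
  have "2 < exp (1 :: real)" using exp_lower_Taylor_quadratic[of 1] by simp
  then have e2: "(\<lambda>n. sqrt (2 / exp 1) ^ n) \<longlonglongrightarrow> 0"
    by (intro LIMSEQ_realpow_zero) auto
  have e3: "(\<lambda>n. 2 * exp 2 / p n) \<longlonglongrightarrow> 0"
  proof (rule tendsto_sandwich[where f = "\<lambda>_. 0"])
    show "(\<lambda>n. 2 * exp 2 / real n :: real) \<longlonglongrightarrow> 0" by real_asymp
    show "eventually (\<lambda>n. 2 * exp 2 / real (p n) \<le> 2 * exp 2 / real n) sequentially"
      using ev3
    proof eventually_elim
      case (elim n)
      then show ?case using basic(3)[of n] by (intro divide_left_mono mult_pos_pos) auto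
    qed
  qed auto
  \<comment> \<open>Since \<open>L \<le> 2 * P\<close> and 1 - \<alpha> \<le> 1/2, \<open>L\<close>
    is at most 2 sqrt n ln n, so \<open>q\<close> is at most of order n^(-1/8) sqrt (ln n).\<close>
  have "q \<longlonglongrightarrow> 0"
  proof (rule tendsto_sandwich[where f = "\<lambda>_. 0"])
    show "(\<lambda>n. sqrt (4 * exp 1 * (real n powr (1 / 2) * ln (real n))) * real n powr (- 3 / 8)) \<longlonglongrightarrow> 0"
      by real_asymp
    show "eventually (\<lambda>n. q n \<le> sqrt (4 * exp 1 * (real n powr (1 / 2) * ln (real n))) * real n powr (- 3 / 8)) sequentially"
      using P_small[of 1, simplified] ev3
    proof eventually_elim
      case (elim n)
      note b = basic[OF elim(2)]
      have "L n \<le> 2 * P n" using b by (simp add: L_def)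
      also have "P n \<le> real n powr (1 / 2) * N n"
        using elim b \<open>1 / 2 \<le> \<alpha>\<close>
        by (intro order_trans[OF elim(1)]) (auto intro!: mult_right_mono powr_mono)
      finally show ?case
        unfolding q_def N_def by (intro mult_right_mono real_sqrt_le_mono) (auto simp: mult.commute)
    qed
    show "eventually (\<lambda>n. 0 \<le> q n) sequentially"
      using ev3
    proof eventually_elim
      case (elim n)
      then have "L n \<ge> 0" using basic[of n] by (simp add: L_def)
      then show ?case by (simp add: q_def)
    qed
  qed simp
  then have "(\<lambda>n. exp (q n) - 1) \<longlonglongrightarrow> exp 0 - 1" by (intro tendsto_intros)
  then have "err \<longlonglongrightarrow> 0 + 0 + 0 + (exp 0 - 1)"
    unfolding err_def by (intro tendsto_add e1 e2 e3)
  then have "(\<lambda>n. 1 - err n) \<longlonglongrightarrow> 1 - (0 + 0 + 0 + (exp 0 - 1))" by (intro tendsto_intros)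
  then have "(\<lambda>n. 1 - err n) \<longlonglongrightarrow> 1" by simp
  from tendsto_sandwich[OF lower upper this tendsto_const] show ?thesis
    unfolding good_def .
qed

end
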